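(* Let $\tau>0$ and $p$ be such that $p\in\left(e^2,\ \exp\left(1+\frac{e^{-1-\tau}}{\tau}\right)\right)$ and $\zeta>\ln p$, where $\zeta=\zeta(\tau,p)$ is the number defined in the context. Then there exists $\hat c(\tau,p)>0$ such that for each $c\ge \hat c(\tau,p)$ the equation $$\partial_t u(t,x)=\partial_{xx}u(t,x)-u(t,x)+p\,u(t-\tau,x)e^{-u(t-\tau,x)},\quad x\in\mathbb{R},$$ has a positive wavefront $u(t,x)=\phi_c(x+ct)$ propagating with the speed $c$ whose profile $\phi_c$ is eventually monotone at $-\infty$ and at $+\infty$ and is non-monotone on $\mathbb{R}$. In fact, $|\phi_c(\cdot)|_\infty\ge\zeta>\ln p$.
   Context: A wavefront propagating with speed $c$ is a solution of the form $u(t,x)=\phi(x+ct)$ with $\phi(-\infty)=0$ and $\phi(+\infty)=\ln p$; $\phi:\mathbb{R}\to\mathbb{R}$ is called its profile, and the wavefront is positive if $\phi(t)>0$ for all $t\in\mathbb{R}$. A function is eventually monotone at $+\infty$ (at $-\infty$) if it is monotone on some neighbourhood $[T,+\infty)$ (respectively $(-\infty,T]$). $|\phi|_\infty=\sup_{t\in\mathbb{R}}|\phi(t)|$. Let $\Gamma(z,s)=\int_0^z t^{s-1}e^{-t}\,dt$ be the lower incomplete gamma function and $\chi(z)=z+1-pe^{-z\tau}$. For each $p>1$ the equation $\chi(z)=0$ has exactly one positive root, denoted by $\mu$. Set $\bar q_2:=-pe^{-2\mu\tau}/\chi(2\mu)<0$, $m:=\mu^{-1}$ and $$\zeta:=(1+\bar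 q_2)e^{-\tau}+pm\left(\Gamma(1,m+1)-\Gamma(e^{-\mu\tau},m+1)+\bar q_2\Gamma(1,m+2)-\bar q_2\Gamma(e^{-\mu\tau},m+2)\right).$$ *)

theory Defs
  imports "HOL-Analysis.Analysis"
begin

definition lower_Gamma :: "real \<Rightarrow> real \<Rightarrow> real" where
  "lower_Gamma z s = integral {0..z} (\<lambda>t. t powr (s - 1) * exp (- t))"

definition char_fun :: "real \<Rightarrow> real \<Rightarrow> real \<Rightarrow> real" where
  "char_fun \<tau> p z = z + 1 - p * exp (- z * \<tau>)"

lemma char_fun_ex1_pos_root:
  assumes "\<tau> > 0" "p > 1"
  shows "\<exists>!z. z > 0 \<and> char_fun \<tau> p z = 0"
proof (rule ex_ex1I)
  have "continuous_on {0..p} (char_fun \<tau> p)"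
    unfolding char_fun_def by (intro continuous_intros)
  moreover have "char_fun \<tau> p 0 \<le> 0"
    using assms by (simp add: char_fun_def)
  moreover have "0 \<le> char_fun \<tau> p p"
  proof -
    have "p * exp (- p * \<tau>) \<le> p * 1"
      using assms by (intro mult_left_mono) auto
    then show ?thesis by (simp add: char_fun_def)
  qed
  ultimately obtain z where z: "0 \<le> z" "char_fun \<tau> p z = 0"
    using IVT'[of "char_fun \<tau> p" 0 0 p] assms by auto
  moreover have "z \<noteq> 0"
    using z assms by (auto simp: char_fun_def)
  ultimately show "\<exists>z. z > 0 \<and> char_fun \<tau> p z = 0"
    by (intro exI[of _ z]) auto
next
  fix y z
  assume *: "y > 0 \<and> char_fun \<tau> p y = 0" "z > 0 \<and> char_fun \<tau> p z = 0"
  have "char_fun \<tau> p a < char_fun \<tau> p b" if "a < b" for a b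
  proof -
    have "p * exp (- b * \<tau>) \<le> p * exp (- a * \<tau>)"
      using assms that by (intro mult_left_mono) auto
    then show ?thesis
      using that by (simp add: char_fun_def)
  qed
  from this[of y z] this[of z y] show "y = z"
    using * by (cases y z rule: linorder_cases) auto
qed

definition mu_root :: "real \<Rightarrow> real \<Rightarrow> real" where
  "mu_root \<tau> p = (THE z. z > 0 \<and> char_fun \<tau> p z = 0)"

definition q2 :: "real \<Rightarrow> real \<Rightarrow> real" where
  "q2 \<tau> p = - p * exp (- 2 * mu_root \<tau> p * \<tau>) / char_fun \<tau> p (2 * mu_root \<tau> p)"

definition zeta_val :: "real \<Rightarrow> real \<Rightarrow> real" where
  "zeta_val \<tau> p =
    (let m = inverse (mu_root \<tau> p); q = q2 \<tau> p; a = exp (- mu_root \<tau> p * \<tau>) in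
      (1 + q) * exp (- \<tau>)
      + p * m * (lower_Gamma 1 (m + 1) - lower_Gamma a (m + 1)
                 + q * lower_Gamma 1 (m + 2) - q * lower_Gamma a (m + 2)))"

text \<open>Classical entire solutions, of class \<open>C\<^sup>1\<close> in \<open>t\<close> and \<open>C\<^sup>2\<close> in \<open>x\<close>;
  \<open>ut\<close>, \<open>ux\<close>, \<open>uxx\<close> are the partial derivatives of \<open>u\<close>.\<close>

definition nicholson_solution ::
    "real \<Rightarrow> real \<Rightarrow> (real \<Rightarrow> real \<Rightarrow> real) \<Rightarrow> bool" where
  "nicholson_solution \<tau> p u \<longleftrightarrow>
    (\<exists>ut ux uxx.
      continuous_on UNIV (\<lambda>(t, x). ut t x) \<and>
      continuous_on UNIV (\<lambda>(t, x). ux t x) \<and>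
      continuous_on UNIV (\<lambda>(t, x). uxx t x) \<and>
      (\<forall>t x.
        ((\<lambda>s. u s x) has_real_derivative ut t x) (at t) \<and>
        ((\<lambda>y. u t y) has_real_derivative ux t x) (at x) \<and>
        ((\<lambda>y. ux t y) has_real_derivative uxx t x) (at x) \<and>
        ut t x = uxx t x - u t x + p * u (t - \<tau>) x * exp (- u (t - \<tau>) x)))"

definition wavefront :: "real \<Rightarrow> real \<Rightarrow> real \<Rightarrow> (real \<Rightarrow> real) \<Rightarrow> bool" where
  "wavefront \<tau> p c \<phi> \<longleftrightarrow>
    nicholson_solution \<tau> p (\<lambda>t x. \<phi> (x + c * t)) \<and>
    (\<phi> \<longlongrightarrow> 0) at_bot \<and> (\<phi> \<longlongrightarrow> ln p) at_top"

definition positive_wavefront :: "real \<Rightarrow> real \<Rightarrow> real \<Rightarrow> (real \<Rightarrow> real) \<Rightarrow> bool" where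
  "positive_wavefront \<tau> p c \<phi> \<longleftrightarrow> wavefront \<tau> p c \<phi> \<and> (\<forall>t. \<phi> t > 0)"

text \<open>Monotone means nondecreasing or nonincreasing.\<close>

definition monotone_real_on :: "real set \<Rightarrow> (real \<Rightarrow> real) \<Rightarrow> bool" where
  "monotone_real_on A f \<longleftrightarrow> mono_on A f \<or> antimono_on A f"

definition ev_monotone_at_top :: "(real \<Rightarrow> real) \<Rightarrow> bool" where
  "ev_monotone_at_top f \<longleftrightarrow> (\<exists>T. monotone_real_on {T..} f)"

definition ev_monotone_at_bot :: "(real \<Rightarrow> real) \<Rightarrow> bool" where
  "ev_monotone_at_bot f \<longleftrightarrow> (\<exists>T. monotone_real_on {..T} f)"

text \<open>The supremum is a genuine one for every wavefront profile: such a profile is continuous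
  with finite limits at both ends, hence bounded.\<close>

definition sup_norm :: "(real \<Rightarrow> real) \<Rightarrow> real" where
  "sup_norm f = (SUP t. \<bar>f t\<bar>)"

end

(* With psi(t) = phi(c t) and eps = 1/c^2 the profile equation becomes
   eps psi'' - psi' - psi + f(psi(t - tau)) = 0 with f(x) = p x exp(-x). Its bounded solutions satisfy
   psi' = nu (v - psi), where v(t) is the expectation of f(psi(t + X - tau)) for an exponential variable X
   of rate z ~ c^2: a delay equation with an exponentially small advanced part. A contraction started at
   exp(mu t) gives psi between exp(mu t) + q exp(2 mu t) and exp(mu t). Integrating over [0, tau] yields
   psi(tau) > zeta > ln p once c is large. From then on y = psi - ln p is positive and y exp((1 + 1/tau) t)
   increases: by convexity of f beyond 2 < ln p the delayed feedback is at most (ln p - 1) y, and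
   (ln p - 1) tau exp(tau + 1) < 1. Hence f(psi) < ln p later on, so psi eventually decreases, and it
   decays to ln p. *)

theory Submission
  imports Defs
begin

section \<open>Exponential averages\<close>

text \<open>At finite speed the equation looks ahead, so it cannot be integrated from one delay
  interval to the next: values beyond a given time must be bounded without being known. A free rate
  \<open>l\<close> with \<open>2 * l \<le> z\<close> does this. At times later than \<tau> the crude
  bound \<open>p\<close> is at most \<open>p * exp (l * (t - \<tau>))\<close>, and
  \<open>profile_op\<close> multiplies that exponential by at most \<open>2 / l\<close>. Errors are
  thus fixed through \<open>l\<close> alone, and only afterwards is c taken large.

  The linearisation at 0 reproduces the exponential of rate \<mu> exactly, so a weight of that rate
  gives no contraction; fixing its coefficient selects one translate of the wave, and the remaining
  error of rate 2\<mu> shrinks.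

  The exponent 1 + 1/\<tau> minimises exp (L * \<tau>) / (L - 1) over L > 1. Hence the upper bound
  on p says that the linearisation y'(t) = - y(t) - (ln p - 1) y(t - \<tau>) at the equilibrium has
  solutions exp (- L * t) with real L, that is, it admits decay without oscillation; below the bound
  there is room for the perturbation caused by finite speed.\<close>

text \<open>\<open>avg k F t\<close> is the expectation of \<open>F (t + X)\<close> with \<open>X\<close> exponentially distributed of rate \<open>k\<close>,
  and \<open>past k F t\<close> that of \<open>F (t - X)\<close>; the shift is absorbed into the factor \<open>exp (k * t)\<close>.\<close>

definition avg :: "real \<Rightarrow> (real \<Rightarrow> real) \<Rightarrow> real \<Rightarrow> real" where
  "avg k F t = k * exp (k * t) * integral {t..} (\<lambda>s. exp (- k * s) * F s)"

definition past :: "real \<Rightarrow> (real \<Rightarrow> real) \<Rightarrow> real \<Rightarrow> real" where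
  "past k F t = avg k (\<lambda>s. F (- s)) (- t)"

lemma bcontfunI_bound:
  fixes F :: "real \<Rightarrow> real"
  assumes "continuous_on UNIV F" "\<And>t. \<bar>F t\<bar> \<le> M"
  shows "F \<in> bcontfun"
  using assms by (auto simp: bcontfun_def bounded_iff)

lemma bcontfun_boundE:
  fixes F :: "real \<Rightarrow> real"
  assumes "F \<in> bcontfun"
  obtains M where "\<And>t. \<bar>F t\<bar> \<le> M"
  using assms by (auto simp: bcontfun_def bounded_iff)

lemma bcontfun_compose:
  fixes F :: "real \<Rightarrow> real"
  assumes "F \<in> bcontfun" "continuous_on UNIV g"
  shows "(\<lambda>t. F (g t)) \<in> bcontfun"
  using assms continuous_on_compose2[of UNIV F UNIV g]
  by (auto simp: bcontfun_def bounded_iff)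

lemma avg_integrable:
  fixes F :: "real \<Rightarrow> real"
  assumes "F \<in> bcontfun" "k > 0"
  shows "(\<lambda>s. exp (- k * s) * F s) integrable_on {t..}"
proof -
  obtain M where M: "\<And>t. \<bar>F t\<bar> \<le> M" using bcontfun_boundE[OF assms(1)] by blast
  have c: "continuous_on UNIV F" using assms by (simp add: bcontfun_def)
  show ?thesis
  proof (rule measurable_bounded_by_integrable_imp_integrable)
    show "(\<lambda>s. exp (- k * s) * F s) \<in> borel_measurable (lebesgue_on {t..})"
      by (intro continuous_imp_measurable_on_sets_lebesgue continuous_intros
          continuous_on_subset[OF c]) auto
    show "(\<lambda>s. M * exp (- k * s)) integrable_on {t..}"
      using integrable_on_cmult_left[OF integrable_on_exp_minus_to_infinity[OF assms(2)], of M t] by simp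
    show "norm (exp (- k * s) * F s) \<le> M * exp (- k * s)" for s
      using M[of s] by (simp add: abs_mult mult.commute)
  qed auto
qed

lemma exp_avg_has_integral:
  fixes k l :: real
  assumes "l < k"
  shows "((\<lambda>s. exp (- k * s) * exp (l * s)) has_integral exp (- k * t) * exp (l * t) / (k - l)) {t..}"
  using has_integral_exp_minus_to_infinity[of "k - l" t] assms
  by (simp add: exp_add[symmetric] algebra_simps)

text \<open>A constant and two exponentials suffice as majorants throughout: the average multiplies
  \<open>exp (l * t)\<close> by \<open>k / (k - l)\<close>, so a comparison of functions becomes one
  of three coefficients.\<close>

lemma avg_le:
  assumes F: "F \<in> bcontfun" and k: "k > 0" "l1 < k" "l2 < k"
    and le: "\<And>s. s \<ge> t \<Longrightarrow> F s \<le> a + b1 * exp (l1 * s) + b2 * exp (l2 * s)"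
  shows "avg k F t \<le> a + b1 * (k / (k - l1)) * exp (l1 * t) + b2 * (k / (k - l2)) * exp (l2 * t)"
proof -
  let ?G = "\<lambda>s. a * (exp (- k * s) * exp (0 * s)) + b1 * (exp (- k * s) * exp (l1 * s))
    + b2 * (exp (- k * s) * exp (l2 * s))"
  let ?I = "a * (exp (- k * t) * exp (0 * t) / (k - 0)) + b1 * (exp (- k * t) * exp (l1 * t) / (k - l1))
    + b2 * (exp (- k * t) * exp (l2 * t) / (k - l2))"
  have G: "(?G has_integral ?I) {t..}"
    by (intro has_integral_add has_integral_mult_right exp_avg_has_integral k)
  have "integral {t..} (\<lambda>s. exp (- k * s) * F s) \<le> ?I"
  proof (rule has_integral_le[OF integrable_integral[OF avg_integrable[OF F k(1)]] G])
    fix s assume "s \<in> {t..}"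
    then have "exp (- k * s) * F s \<le> exp (- k * s) * (a + b1 * exp (l1 * s) + b2 * exp (l2 * s))"
      using le by (intro mult_left_mono) auto
    then show "exp (- k * s) * F s \<le> ?G s" by (simp add: algebra_simps)
  qed
  then have "avg k F t \<le> k * exp (k * t) * ?I"
    unfolding avg_def using k by (intro mult_left_mono) auto
  also have "\<dots> = k * (exp (k * t) * exp (- k * t)) * (a / k + b1 * (exp (l1 * t) / (k - l1))
    + b2 * (exp (l2 * t) / (k - l2)))"
    by (simp add: algebra_simps)
  also have "exp (k * t) * exp (- k * t) = 1"
    by (simp add: exp_add[symmetric])
  also have "k * 1 * (a / k + b1 * (exp (l1 * t) / (k - l1)) + b2 * (exp (l2 * t) / (k - l2)))
    = a + b1 * (k / (k - l1)) * exp (l1 * t) + b2 * (k / (k - l2)) * exp (l2 * t)"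
    using k by (simp add: algebra_simps)
  finally show ?thesis .
qed

lemma avg_diff:
  assumes "F \<in> bcontfun" "G \<in> bcontfun" "k > 0"
  shows "avg k (\<lambda>s. F s - G s) t = avg k F t - avg k G t"
  unfolding avg_def right_diff_distrib
  by (subst integral_diff[OF avg_integrable[OF assms(1,3)] avg_integrable[OF assms(2,3)]])
    (simp add: algebra_simps)

lemma avg_uminus: "avg k (\<lambda>s. - F s) t = - avg k F t"
  by (simp add: avg_def)

lemma bcontfun_uminus: "F \<in> bcontfun \<Longrightarrow> (\<lambda>s. - F s :: real) \<in> bcontfun"
  by (auto simp: bcontfun_def bounded_iff intro: continuous_intros)

lemma bcontfun_diff:
  fixes F G :: "real \<Rightarrow> real"
  assumes "F \<in> bcontfun" "G \<in> bcontfun"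
  shows "(\<lambda>s. F s - G s) \<in> bcontfun"
  by (rule minus_cont) (fact assms)+

lemma avg_ge:
  assumes F: "F \<in> bcontfun" and k: "k > 0" "l1 < k" "l2 < k"
    and le: "\<And>s. s \<ge> t \<Longrightarrow> F s \<ge> a + b1 * exp (l1 * s) + b2 * exp (l2 * s)"
  shows "avg k F t \<ge> a + b1 * (k / (k - l1)) * exp (l1 * t) + b2 * (k / (k - l2)) * exp (l2 * t)"
proof -
  have "- F s \<le> - a + - b1 * exp (l1 * s) + - b2 * exp (l2 * s)" if "s \<ge> t" for s
    using le[OF that] by simp
  from avg_le[OF bcontfun_uminus[OF F] k this, of t] show ?thesis
    by (simp add: avg_uminus)
qed

lemma avg_const_bounds:
  assumes "F \<in> bcontfun" "k > 0"
  shows "(\<And>s. s \<ge> t \<Longrightarrow> F s \<le> a) \<Longrightarrow> avg k F t \<le> a"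
    and "(\<And>s. s \<ge> t \<Longrightarrow> F s \<ge> a) \<Longrightarrow> avg k F t \<ge> a"
  using avg_le[OF assms, of 0 0 t a 0 0] avg_ge[OF assms, of 0 0 t a 0 0] assms(2) by auto

lemma avg_deriv:
  assumes F: "F \<in> bcontfun" and k: "k > 0"
  shows "(avg k F has_real_derivative k * (avg k F t - F t)) (at t)"
proof -
  have c: "continuous_on UNIV F" using F by (simp add: bcontfun_def)
  let ?h = "\<lambda>s. exp (- k * s) * F s"
  let ?I = "integral {t + 1..} ?h"
  have ch: "continuous_on A ?h" for A
    by (intro continuous_intros continuous_on_subset[OF c]) auto
  \<comment> \<open>Cutting at the fixed time \<open>t + 1\<close> leaves the variable endpoint in a
    compact interval, where the fundamental theorem applies.\<close>
  have split: "integral {u..} ?h = integral {u..t + 1} ?h + ?I" if "u < t + 1" for u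
  proof -
    have "(?h has_integral integral {u..t + 1} ?h + ?I) ({u..t + 1} \<union> {t + 1..})"
    proof (intro has_integral_Un integrable_integral)
      show "?h integrable_on {u..t + 1}"
        by (rule integrable_continuous_interval[OF ch])
      show "?h integrable_on {t + 1..}" by (rule avg_integrable[OF F k])
      have "{u..t + 1} \<inter> {t + 1..} \<subseteq> {t + 1}" by auto
      then show "negligible ({u..t + 1} \<inter> {t + 1..})"
        using negligible_sing negligible_subset by blast
    qed
    moreover have "{u..t + 1} \<union> {t + 1..} = {u..}" using that by auto
    ultimately show ?thesis by (simp add: integral_unique)
  qed
  have "((\<lambda>u. integral {u..t + 1} ?h) has_real_derivative - ?h t) (at t within {t - 1..t + 1})"
    by (rule integral_has_real_derivative'[OF ch]) auto
  then have d: "((\<lambda>u. integral {u..t + 1} ?h) has_real_derivative - ?h t) (at t)"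
    by (simp add: at_within_Icc_at)
  have "((\<lambda>u. k * exp (k * u) * (integral {u..t + 1} ?h + ?I)) has_real_derivative
      k * (k * exp (k * t) * (integral {t..t + 1} ?h + ?I)) - k * (exp (k * t) * ?h t)) (at t)"
    by (rule derivative_eq_intros d refl | simp add: algebra_simps)+
  moreover have "exp (k * t) * ?h t = F t"
    by (simp add: exp_minus)
  moreover have "integral {t..t + 1} ?h + ?I = integral {t..} ?h"
    using split[of t] by simp
  ultimately have "((\<lambda>u. k * exp (k * u) * (integral {u..t + 1} ?h + ?I)) has_real_derivative
      k * (avg k F t - F t)) (at t)"
    by (simp only: avg_def right_diff_distrib)
  then show ?thesis
  proof (rule has_field_derivative_transform_within_open)
    show "open {..<t + 1}" "t \<in> {..<t + 1}" by auto
    show "k * exp (k * u) * (integral {u..t + 1} ?h + ?I) = avg k F u" if "u \<in> {..<t + 1}" for u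
      using split[of u] that by (simp add: avg_def)
  qed
qed

lemma avg_bcontfun:
  assumes F: "F \<in> bcontfun" and k: "k > 0"
  shows "avg k F \<in> bcontfun"
proof -
  obtain M where M: "\<And>t. \<bar>F t\<bar> \<le> M" using bcontfun_boundE[OF F] by blast
  have "\<bar>avg k F t\<bar> \<le> M" for t
  proof -
    have "F s \<le> M" "- M \<le> F s" for s using M[of s] by auto
    then show ?thesis using avg_const_bounds[OF F k, of t M] avg_const_bounds[OF F k, of t "- M"]
      by (intro abs_leI) auto
  qed
  moreover have "continuous_on UNIV (avg k F)"
    by (meson DERIV_continuous_on avg_deriv[OF F k] has_field_derivative_at_within)
  ultimately show ?thesis by (rule bcontfunI_bound[rotated])
qed

lemma bcontfun_reflect: "F \<in> bcontfun \<Longrightarrow> (\<lambda>s :: real. F (- s) :: real) \<in> bcontfun"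
  using bcontfun_compose[of F uminus] by (simp add: continuous_on_minus)

context
  fixes F :: "real \<Rightarrow> real" and k :: real
  assumes F: "F \<in> bcontfun" and k: "k > 0"
begin

lemma past_le:
  assumes "- k < l1" "- k < l2"
    and "\<And>s. s \<le> t \<Longrightarrow> F s \<le> a + b1 * exp (l1 * s) + b2 * exp (l2 * s)"
  shows "past k F t \<le> a + b1 * (k / (k + l1)) * exp (l1 * t) + b2 * (k / (k + l2)) * exp (l2 * t)"
proof -
  have "F (- s) \<le> a + b1 * exp (- l1 * s) + b2 * exp (- l2 * s)" if "s \<ge> - t" for s
    using assms(3)[of "- s"] that by simp
  from avg_le[OF bcontfun_reflect[OF F] k _ _ this, of "- t"] assms(1,2) show ?thesis
    by (simp add: past_def)
qed

lemma past_deriv: "(past k F has_real_derivative k * (F t - past k F t)) (at t)"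
proof -
  have "(avg k (\<lambda>s. F (- s)) has_real_derivative k * (avg k (\<lambda>s. F (- s)) (- t) - F (- (- t)))) (at (- t))"
    by (rule avg_deriv[OF bcontfun_reflect[OF F] k])
  from DERIV_chain'[OF DERIV_minus[OF DERIV_ident] this] show ?thesis
    by (simp add: past_def[abs_def] right_diff_distrib)
qed

lemma past_bcontfun: "past k F \<in> bcontfun"
  using bcontfun_compose[OF avg_bcontfun[OF bcontfun_reflect[OF F] k], of uminus]
  by (simp add: past_def[abs_def] continuous_intros)

end

lemma past_diff:
  assumes "F \<in> bcontfun" "G \<in> bcontfun" "k > 0"
  shows "past k (\<lambda>s. F s - G s) t = past k F t - past k G t"
  unfolding past_def by (intro avg_diff bcontfun_reflect assms)

lemma past_uminus: "past k (\<lambda>s. - F s) t = - past k F t"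
  by (simp add: past_def avg_uminus)

text \<open>For \<open>\<epsilon> * \<nu> * z = 1\<close> and \<open>\<epsilon> * (z - \<nu>) = 1\<close>, \<open>profile_op \<nu> z F\<close> is the bounded solution of
  \<open>\<epsilon> \<phi>'' - \<phi>' - \<phi> + F = 0\<close>, and it multiplies \<open>exp (l * t)\<close> by \<open>gain \<nu> z l\<close>.\<close>

definition profile_op :: "real \<Rightarrow> real \<Rightarrow> (real \<Rightarrow> real) \<Rightarrow> real \<Rightarrow> real" where
  "profile_op \<nu> z F = past \<nu> (avg z F)"

definition gain :: "real \<Rightarrow> real \<Rightarrow> real \<Rightarrow> real" where
  "gain \<nu> z l = \<nu> * z / ((\<nu> + l) * (z - l))"

context
  fixes \<nu> z :: real
  assumes pos: "\<nu> > 0" "z > 0"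
begin

lemma profile_op_le:
  assumes F: "F \<in> bcontfun" and l: "- \<nu> < l1" "l1 < z" "- \<nu> < l2" "l2 < z"
    and le: "\<And>s. F s \<le> a + b1 * exp (l1 * s) + b2 * exp (l2 * s)"
  shows "profile_op \<nu> z F t
    \<le> a + b1 * gain \<nu> z l1 * exp (l1 * t) + b2 * gain \<nu> z l2 * exp (l2 * t)"
proof -
  have "avg z F s \<le> a + (b1 * (z / (z - l1))) * exp (l1 * s) + (b2 * (z / (z - l2))) * exp (l2 * s)" for s
    using avg_le[OF F pos(2) l(2) l(4)] le by simp
  from past_le[OF avg_bcontfun[OF F pos(2)] pos(1) l(1) l(3) this, of t]
  show ?thesis by (simp add: profile_op_def gain_def mult_ac)
qed

lemma profile_op_diff:
  assumes "F \<in> bcontfun" "G \<in> bcontfun"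
  shows "profile_op \<nu> z (\<lambda>s. F s - G s) t = profile_op \<nu> z F t - profile_op \<nu> z G t"
proof -
  have "avg z (\<lambda>s. F s - G s) = (\<lambda>s. avg z F s - avg z G s)"
    using avg_diff[OF assms pos(2)] by auto
  then show ?thesis
    unfolding profile_op_def using past_diff avg_bcontfun assms pos by simp
qed

lemma profile_op_ge:
  assumes F: "F \<in> bcontfun" and l: "- \<nu> < l1" "l1 < z" "- \<nu> < l2" "l2 < z"
    and ge: "\<And>s. F s \<ge> a + b1 * exp (l1 * s) + b2 * exp (l2 * s)"
  shows "profile_op \<nu> z F t
    \<ge> a + b1 * gain \<nu> z l1 * exp (l1 * t) + b2 * gain \<nu> z l2 * exp (l2 * t)"
proof -
  have "profile_op \<nu> z (\<lambda>s. - F s) t = - profile_op \<nu> z F t"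
    by (simp add: profile_op_def avg_uminus[abs_def] past_uminus)
  moreover have "- F s \<le> - a + - b1 * exp (l1 * s) + - b2 * exp (l2 * s)" for s
    using ge[of s] by simp
  from profile_op_le[OF bcontfun_uminus[OF F] l this, of t]
  have "profile_op \<nu> z (\<lambda>s. - F s) t
    \<le> - a + - b1 * gain \<nu> z l1 * exp (l1 * t) + - b2 * gain \<nu> z l2 * exp (l2 * t)" .
  ultimately show ?thesis by simp
qed

lemma profile_op_bcontfun: "F \<in> bcontfun \<Longrightarrow> profile_op \<nu> z F \<in> bcontfun"
  unfolding profile_op_def by (intro past_bcontfun avg_bcontfun pos)

end

section \<open>Existence of the profile\<close>

definition nich :: "real \<Rightarrow> real \<Rightarrow> real" where
  "nich p x = p * x * exp (- x)"

lemma nich_deriv: "(nich p has_real_derivative p * (1 - x) * exp (- x)) (at x)"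
  unfolding nich_def[abs_def]
  by (rule derivative_eq_intros refl | simp add: algebra_simps)+

lemma continuous_on_nich [continuous_intros]:
  "continuous_on A g \<Longrightarrow> continuous_on A (\<lambda>x. nich p (g x))"
  unfolding nich_def by (intro continuous_intros)

context
  fixes p :: real
  assumes p: "p > 0"
begin

lemma nich_nonneg: "x \<ge> 0 \<Longrightarrow> nich p x \<ge> 0"
  using p by (simp add: nich_def)

lemma nich_le_linear: "x \<ge> 0 \<Longrightarrow> nich p x \<le> p * x"
  using p mult_left_mono[of "exp (- x)" 1 "p * x"] by (simp add: nich_def)

lemma nich_le: "nich p x \<le> p"
proof -
  have "x \<le> exp x" using exp_ge_add_one_self[of x] by linarith
  then have "x * exp (- x) \<le> exp x * exp (- x)"
    by (intro mult_right_mono) auto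
  then show ?thesis
    using p mult_left_mono[of "x * exp (- x)" 1 p] by (simp add: nich_def exp_minus mult.assoc)
qed

lemma nich_ge_quadratic: "x \<ge> 0 \<Longrightarrow> nich p x \<ge> p * x - p * x\<^sup>2"
  using p mult_left_mono[of "1 - x" "exp (- x)" "p * x"] exp_ge_add_one_self[of "- x"]
  by (simp add: nich_def algebra_simps power2_eq_square)

lemma nich_lipschitz:
  assumes "x \<ge> 0" "y \<ge> 0"
  shows "\<bar>nich p x - nich p y\<bar> \<le> p * \<bar>x - y\<bar>"
proof -
  have "\<bar>1 - u\<bar> * exp (- u) \<le> 1" if "u \<ge> 0" for u :: real
  proof -
    have "\<bar>1 - u\<bar> \<le> exp u" using exp_ge_add_one_self[of u] that by linarith
    then have "\<bar>1 - u\<bar> * exp (- u) \<le> exp u * exp (- u)"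
      by (intro mult_right_mono) auto
    then show ?thesis by (simp add: exp_minus)
  qed
  then have "norm (p * (1 - u) * exp (- u)) \<le> p" if "u \<in> {0..}" for u
    using p that mult_left_mono[of "\<bar>1 - u\<bar> * exp (- u)" 1 p] by (simp add: abs_mult mult.assoc)
  from field_differentiable_bound[of "{0..}" "nich p", OF _ has_field_derivative_at_within[OF nich_deriv] this]
  show ?thesis using assms by (simp add: convex_real_interval)
qed

lemma nich_mono: "0 \<le> x \<Longrightarrow> x \<le> y \<Longrightarrow> y \<le> 1 \<Longrightarrow> nich p x \<le> nich p y"
  using p by (intro DERIV_nonneg_imp_nondecreasing[of x y "nich p"])
    (auto intro!: exI conjI nich_deriv mult_nonneg_nonneg)

lemma nich_strict_antimono:
  assumes "1 \<le> x" "x < y"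
  shows "nich p y < nich p x"
proof (rule DERIV_neg_imp_decreasing_open[OF assms(2)])
  fix u assume "x < u" "u < y"
  then have "p * (1 - u) * exp (- u) < 0"
    using p assms by (intro mult_neg_pos mult_pos_neg) auto
  then show "\<exists>d. (nich p has_real_derivative d) (at u) \<and> d < 0"
    using nich_deriv by blast
qed (intro continuous_intros)

lemma nich_fixed_point: "nich p (ln p) = ln p"
  using p by (simp add: nich_def exp_minus)

text \<open>The right side is the tangent at the equilibrium. The derivative of the difference is
  nonnegative because \<open>u * exp (- u) \<le> 1 - exp (- u)\<close> and the factor
  \<open>ln p - 1\<close> is at least 1, which is where \<open>ln p \<ge> 2\<close> enters.\<close>

lemma nich_ge_tangent:
  assumes "ln p \<ge> 2" "y \<ge> 0"
  shows "nich p (ln p + y) \<ge> ln p - (ln p - 1) * y"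
proof -
  let ?k = "ln p"
  let ?h = "\<lambda>y. nich p (?k + y) + (?k - 1) * y"
  have "?h 0 \<le> ?h y"
  proof (rule DERIV_nonneg_imp_nondecreasing[OF assms(2)])
    fix u :: real assume u: "0 \<le> u"
    have "(?h has_real_derivative p * (1 - (?k + u)) * exp (- (?k + u)) + (?k - 1)) (at u)"
      by (rule derivative_eq_intros DERIV_chain'[OF _ nich_deriv] refl | simp)+
    moreover have "p * (1 - (?k + u)) * exp (- (?k + u)) + (?k - 1)
        = (?k - 1) * (1 - exp (- u)) - u * exp (- u)"
      using p by (simp add: exp_diff exp_minus field_simps)
    moreover have "u * exp (- u) \<le> 1 - exp (- u)"
    proof -
      have "(1 + u) * exp (- u) \<le> exp u * exp (- u)"
        by (intro mult_right_mono exp_ge_add_one_self) auto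
      then show ?thesis by (simp add: exp_minus algebra_simps)
    qed
    moreover have "1 - exp (- u) \<le> (?k - 1) * (1 - exp (- u))"
      using assms u mult_right_mono[of 1 "?k - 1" "1 - exp (- u)"] by simp
    ultimately show "\<exists>d. (?h has_real_derivative d) (at u) \<and> 0 \<le> d"
      by (intro exI[of _ "p * (1 - (?k + u)) * exp (- (?k + u)) + (?k - 1)"]) auto
  qed
  then show ?thesis by (simp add: nich_fixed_point)
qed

end

text \<open>\<open>\<mu>\<close> is the rate of the leading exponential at \<open>-\<infinity>\<close>. The last assumption makes the nonlinear operator
  a contraction in the norm weighted by \<open>exp (2 * \<mu> * t)\<close>; it works because \<open>p\<close>, the slope of the nonlinearity
  at \<open>0\<close>, is also its Lipschitz constant on the half line.\<close>

locale wave_params =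
  fixes \<tau> p \<nu> z \<mu> :: real
  assumes tau: "\<tau> > 0" and p1: "p > 1"
    and nu: "0 < \<nu>" "\<nu> \<le> 1" and mu: "0 < \<mu>" "2 * \<mu> < z"
    and char: "p * exp (- \<mu> * \<tau>) * gain \<nu> z \<mu> = 1"
    and contraction: "p * exp (- 2 * \<mu> * \<tau>) * gain \<nu> z (2 * \<mu>) < 1"
begin

definition "rate = p * exp (- 2 * \<mu> * \<tau>) * gain \<nu> z (2 * \<mu>)"
text \<open>The solution of \<open>(q - 1) * rate = q\<close>. With this value the lower barrier
  reproduces itself: the quadratic loss of the nonlinearity turns \<open>q\<close> into
  \<open>q - 1\<close>, and the delay and the averages multiply by \<open>rate\<close>.\<close>

definition "q = - rate / (1 - rate)"

definition "delayed \<phi> = (\<lambda>s. nich p (\<phi> (s - \<tau>)))"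

text \<open>Both barriers have the same leading exponential with coefficient 1, so two admissible
  functions differ at most by a multiple of \<open>exp (2 * \<mu> * t)\<close>, the weight in which
  the operator contracts.\<close>

definition admissible :: "(real \<Rightarrow> real) \<Rightarrow> bool" where
  "admissible \<phi> \<longleftrightarrow> continuous_on UNIV \<phi> \<and>
    (\<forall>t. 0 \<le> \<phi> t \<and> \<phi> t \<le> exp (\<mu> * t) \<and> exp (\<mu> * t) + q * exp (2 * \<mu> * t) \<le> \<phi> t)"

lemma p0: "p > 0" using p1 by simp

lemma z0: "z > 0" using mu by simp

lemma rate_pos: "rate > 0"
  using p1 nu mu by (simp add: rate_def gain_def)

lemma rate_less_1: "rate < 1"
  using contraction by (simp add: rate_def)

lemma q_neg: "q < 0"
  using rate_pos rate_less_1 by (simp add: q_def)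

lemma iteration_const_nonneg: "q / (1 - rate) \<le> 0"
  using q_neg rate_less_1 by (simp add: divide_nonpos_pos)

lemma q_eq: "(q - 1) * rate = q"
  using rate_less_1 by (simp add: q_def field_simps)

section \<open>Invariance of the barriers and contraction\<close>

lemma delayed_bounds:
  assumes "admissible \<phi>"
  shows "0 \<le> delayed \<phi> s" "delayed \<phi> s \<le> p"
  using assms nich_nonneg[OF p0] nich_le[OF p0] by (auto simp: admissible_def delayed_def)

lemma delayed_bcontfun:
  assumes "admissible \<phi>"
  shows "delayed \<phi> \<in> bcontfun"
proof (rule bcontfunI_bound[where M = p])
  have c: "continuous_on UNIV \<phi>" using assms by (simp add: admissible_def)
  show "continuous_on UNIV (delayed \<phi>)"
    unfolding delayed_def by (intro continuous_intros continuous_on_compose2[OF c]) auto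
  show "\<bar>delayed \<phi> s\<bar> \<le> p" for s using delayed_bounds[OF assms, of s] by simp
qed

lemma delayed_le_exp:
  assumes "admissible \<phi>"
  shows "delayed \<phi> s \<le> p * exp (- \<mu> * \<tau>) * exp (\<mu> * s)"
proof -
  have "delayed \<phi> s \<le> p * \<phi> (s - \<tau>)"
    using assms nich_le_linear[OF p0] by (auto simp: admissible_def delayed_def)
  also have "\<dots> \<le> p * exp (\<mu> * (s - \<tau>))"
    using assms p0 by (intro mult_left_mono) (auto simp: admissible_def)
  finally show ?thesis by (simp add: algebra_simps flip: exp_add)
qed

text \<open>With e = exp (\<mu> * (s - \<tau>)), the delayed value x lies between e + q e^2 and e,
  so x - x^2 is at least e + (q - 1) e^2.\<close>

lemma delayed_ge_exp:
  assumes "admissible \<phi>"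
  shows "delayed \<phi> s \<ge> p * exp (- \<mu> * \<tau>) * exp (\<mu> * s)
    + (q - 1) * p * exp (- 2 * \<mu> * \<tau>) * exp (2 * \<mu> * s)"
proof -
  let ?x = "\<phi> (s - \<tau>)" and ?e = "exp (\<mu> * (s - \<tau>))"
  have "?e\<^sup>2 = exp (2 * \<mu> * (s - \<tau>))"
    by (simp add: power2_eq_square flip: exp_add)
  then have x: "0 \<le> ?x" "?x \<le> ?e" "?e + q * ?e\<^sup>2 \<le> ?x"
    using assms unfolding admissible_def by metis+
  have "?x\<^sup>2 \<le> ?e\<^sup>2" using x by (intro power_mono) auto
  then have "?e + (q - 1) * ?e\<^sup>2 \<le> ?x - ?x\<^sup>2"
    using x unfolding left_diff_distrib by linarith
  then have "p * (?e + (q - 1) * ?e\<^sup>2) \<le> p * (?x - ?x\<^sup>2)"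
    using p0 by (intro mult_left_mono) auto
  also have "\<dots> \<le> delayed \<phi> s"
    using nich_ge_quadratic[OF p0 x(1)] by (simp add: delayed_def algebra_simps)
  finally show ?thesis
    by (simp add: power2_eq_square algebra_simps flip: exp_add)
qed

lemma admissible_step:
  assumes "admissible \<phi>"
  shows "admissible (profile_op \<nu> z (delayed \<phi>))"
proof -
  note F = delayed_bcontfun[OF assms]
  have "0 \<le> profile_op \<nu> z (delayed \<phi>) t" for t
    using profile_op_ge[OF nu(1) z0 F, of 0 0 0 0 0 t] nu z0 delayed_bounds[OF assms] by simp
  moreover have "profile_op \<nu> z (delayed \<phi>) t \<le> exp (\<mu> * t)" for t
    using profile_op_le[OF nu(1) z0 F, of \<mu> 0 0 "p * exp (- \<mu> * \<tau>)" 0 t] nu mu char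
      delayed_le_exp[OF assms] by simp
  moreover have "exp (\<mu> * t) + q * exp (2 * \<mu> * t) \<le> profile_op \<nu> z (delayed \<phi>) t" for t
  proof -
    have "0 + (p * exp (- \<mu> * \<tau>)) * gain \<nu> z \<mu> * exp (\<mu> * t)
      + ((q - 1) * p * exp (- 2 * \<mu> * \<tau>)) * gain \<nu> z (2 * \<mu>) * exp (2 * \<mu> * t)
      \<le> profile_op \<nu> z (delayed \<phi>) t"
      using nu mu delayed_ge_exp[OF assms] by (intro profile_op_ge[OF nu(1) z0 F]) auto
    moreover have "((q - 1) * p * exp (- 2 * \<mu> * \<tau>)) * gain \<nu> z (2 * \<mu>) = q"
      using q_eq by (simp add: rate_def mult_ac)
    ultimately show ?thesis using char by simp
  qed
  ultimately show ?thesis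
    using profile_op_bcontfun[OF nu(1) z0 F] by (simp add: admissible_def bcontfun_def)
qed

lemma profile_op_contraction:
  assumes \<phi>: "admissible \<phi>" and \<psi>: "admissible \<psi>"
    and N: "\<And>t. \<bar>\<phi> t - \<psi> t\<bar> \<le> N * exp (2 * \<mu> * t)"
  shows "\<bar>profile_op \<nu> z (delayed \<phi>) t - profile_op \<nu> z (delayed \<psi>) t\<bar>
    \<le> rate * N * exp (2 * \<mu> * t)"
proof -
  have *: "profile_op \<nu> z (delayed \<phi>) t - profile_op \<nu> z (delayed \<psi>) t
    \<le> rate * N * exp (2 * \<mu> * t)"
    if \<phi>: "admissible \<phi>" and \<psi>: "admissible \<psi>"
      and N: "\<And>t. \<bar>\<phi> t - \<psi> t\<bar> \<le> N * exp (2 * \<mu> * t)" for \<phi> \<psi>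
  proof -
    have "delayed \<phi> s - delayed \<psi> s \<le> p * N * exp (- 2 * \<mu> * \<tau>) * exp (2 * \<mu> * s)" for s
    proof -
      have "delayed \<phi> s - delayed \<psi> s \<le> p * \<bar>\<phi> (s - \<tau>) - \<psi> (s - \<tau>)\<bar>"
        using nich_lipschitz[OF p0, of "\<phi> (s - \<tau>)" "\<psi> (s - \<tau>)"] \<phi> \<psi>
        by (auto simp: delayed_def admissible_def)
      also have "\<dots> \<le> p * (N * exp (2 * \<mu> * (s - \<tau>)))"
        using N p0 by (intro mult_left_mono) auto
      finally show ?thesis by (simp add: algebra_simps flip: exp_add)
    qed
    then have "profile_op \<nu> z (\<lambda>s. delayed \<phi> s - delayed \<psi> s) t
      \<le> 0 + (p * N * exp (- 2 * \<mu> * \<tau>)) * gain \<nu> z (2 * \<mu>) * exp (2 * \<mu> * t)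
        + 0 * gain \<nu> z 0 * exp (0 * t)"
      using nu mu by (intro profile_op_le[OF nu(1) z0] bcontfun_diff delayed_bcontfun \<phi> \<psi>) auto
    also have "profile_op \<nu> z (\<lambda>s. delayed \<phi> s - delayed \<psi> s) t
      = profile_op \<nu> z (delayed \<phi>) t - profile_op \<nu> z (delayed \<psi>) t"
      by (rule profile_op_diff[OF nu(1) z0 delayed_bcontfun[OF \<phi>] delayed_bcontfun[OF \<psi>]])
    finally show ?thesis by (simp add: rate_def mult_ac)
  qed
  show ?thesis
    using *[OF \<phi> \<psi> N] *[OF \<psi> \<phi>] N by (simp add: abs_minus_commute abs_le_iff)
qed

section \<open>Picard iteration in the weighted norm\<close>

primrec iterates :: "nat \<Rightarrow> real \<Rightarrow> real" where
  "iterates 0 = (\<lambda>t. exp (\<mu> * t))"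
| "iterates (Suc n) = profile_op \<nu> z (delayed (iterates n))"

lemma admissible_iterates: "admissible (iterates n)"
proof (induction n)
  case 0
  have "q * exp (2 * \<mu> * t) \<le> 0" for t
    using q_neg by (simp add: mult_le_0_iff)
  then show ?case by (simp add: admissible_def continuous_intros)
qed (simp add: admissible_step)

text \<open>The barriers give the base case: the first iterate lies below the starting exponential
  by at most \<open>- q * exp (2 * \<mu> * t)\<close>. Each further step contributes a factor
  \<open>rate\<close>.\<close>

lemma iterates_step: "\<bar>iterates (Suc n) t - iterates n t\<bar> \<le> rate ^ n * - q * exp (2 * \<mu> * t)"
proof (induction n arbitrary: t)
  case 0
  have "iterates 1 t \<le> exp (\<mu> * t)" "exp (\<mu> * t) + q * exp (2 * \<mu> * t) \<le> iterates 1 t"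
    using admissible_iterates[of 1] by (auto simp: admissible_def)
  then show ?case by simp
next
  case (Suc n)
  from profile_op_contraction[OF admissible_iterates admissible_iterates Suc.IH, of t]
  show ?case by (simp add: mult_ac)
qed

text \<open>Keeping the exact partial geometric sum, through the factor \<open>1 - rate ^ j\<close>,
  is what closes the induction.\<close>

lemma iterates_cauchy:
  "\<bar>iterates (n + j) t - iterates n t\<bar> \<le> rate ^ n * (1 - rate ^ j) * (- q / (1 - rate)) * exp (2 * \<mu> * t)"
proof (induction j)
  case (Suc j)
  have "\<bar>iterates (n + Suc j) t - iterates n t\<bar>
    \<le> rate ^ (n + j) * - q * exp (2 * \<mu> * t)
      + rate ^ n * (1 - rate ^ j) * (- q / (1 - rate)) * exp (2 * \<mu> * t)"
    using Suc.IH iterates_step[of "n + j" t] by simp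
  also have "\<dots> = rate ^ n * (1 - rate ^ Suc j) * (- q / (1 - rate)) * exp (2 * \<mu> * t)"
    using rate_less_1 by (simp add: field_simps power_add)
  finally show ?case .
qed simp

definition "profile t = lim (\<lambda>n. iterates n t)"

lemma iterates_dist: "\<bar>iterates (n + j) t - iterates n t\<bar> \<le> rate ^ n * (- q / (1 - rate)) * exp (2 * \<mu> * t)"
proof -
  have "rate ^ n * (1 - rate ^ j) * (- q / (1 - rate)) * exp (2 * \<mu> * t)
    \<le> rate ^ n * 1 * (- q / (1 - rate)) * exp (2 * \<mu> * t)"
    using rate_pos iteration_const_nonneg by (intro mult_right_mono mult_left_mono) auto
  then show ?thesis using iterates_cauchy[of n j t] by simp
qed

lemma rate_power_tendsto: "(\<lambda>n. rate ^ n * c) \<longlonglongrightarrow> 0"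
  using rate_pos rate_less_1 LIMSEQ_power_zero[of rate] tendsto_mult_left_zero by fastforce

lemma iterates_tendsto: "(\<lambda>n. iterates n t) \<longlonglongrightarrow> profile t"
proof -
  have "Cauchy (\<lambda>n. iterates n t)"
  proof (rule metric_CauchyI)
    fix e :: real assume "e > 0"
    let ?c = "(- q / (1 - rate)) * exp (2 * \<mu> * t)"
    have "\<forall>\<^sub>F n in sequentially. rate ^ n * (2 * ?c) < e"
      using rate_power_tendsto \<open>e > 0\<close> by (rule order_tendstoD)
    then obtain M where M: "rate ^ M * (2 * ?c) < e" by (auto simp: eventually_sequentially)
    have b: "\<bar>iterates m t - iterates M t\<bar> \<le> rate ^ M * ?c" if "m \<ge> M" for m
      using iterates_dist[of M "m - M" t] that by (simp add: mult.assoc)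
    then have "dist (iterates m t) (iterates n t) < e" if "m \<ge> M" "n \<ge> M" for m n
      using b[OF that(1)] b[OF that(2)] M unfolding dist_real_def mult.left_commute[of _ 2] by linarith
    then show "\<exists>M. \<forall>m\<ge>M. \<forall>n\<ge>M. dist (iterates m t) (iterates n t) < e" by blast
  qed
  then show ?thesis
    unfolding profile_def by (intro convergent_LIMSEQ_iff[THEN iffD1] real_Cauchy_convergent)
qed

lemma profile_dist: "\<bar>profile t - iterates n t\<bar> \<le> rate ^ n * (- q / (1 - rate)) * exp (2 * \<mu> * t)"
proof -
  have "(\<lambda>j. \<bar>iterates (n + j) t - iterates n t\<bar>) \<longlonglongrightarrow> \<bar>profile t - iterates n t\<bar>"
    using LIMSEQ_ignore_initial_segment[OF iterates_tendsto, of n]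
    by (intro tendsto_intros) (simp add: add.commute)
  then show ?thesis
    by (rule tendsto_upperbound) (intro always_eventually allI iterates_dist, simp)
qed

lemma admissible_profile: "admissible profile"
proof -
  \<comment> \<open>The weight \<open>exp (2 * \<mu> * t)\<close> is bounded only on left
    half-lines, so convergence is uniform there and continuity is collected from them.\<close>
  have "continuous_on {..T} profile" for T
  proof (rule uniform_limit_theorem)
    show "uniform_limit {..T} iterates profile sequentially"
    proof (rule uniform_limitI)
      fix e :: real assume "e > 0"
      have "\<forall>\<^sub>F n in sequentially. rate ^ n * (- q / (1 - rate) * exp (2 * \<mu> * T)) < e"
        using rate_power_tendsto \<open>e > 0\<close> by (rule order_tendstoD)
      then show "\<forall>\<^sub>F n in sequentially. \<forall>t\<in>{..T}. dist (iterates n t) (profile t) < e"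
      proof (eventually_elim, intro ballI)
        fix n t assume n: "rate ^ n * (- q / (1 - rate) * exp (2 * \<mu> * T)) < e" and "t \<in> {..T}"
        then have "rate ^ n * (- q / (1 - rate) * exp (2 * \<mu> * t))
          \<le> rate ^ n * (- q / (1 - rate) * exp (2 * \<mu> * T))"
          using rate_pos iteration_const_nonneg mu by (intro mult_left_mono) auto
        then show "dist (iterates n t) (profile t) < e"
          using profile_dist[of t n] n by (simp add: dist_real_def abs_minus_commute mult.assoc)
      qed
    qed
    show "\<forall>\<^sub>F n in sequentially. continuous_on {..T} (iterates n)"
      by (intro always_eventually allI)
        (meson admissible_def admissible_iterates continuous_on_subset subset_UNIV)
  qed simp
  then have "isCont profile t" for t
    using continuous_on_interior[of "{..t + 1}" profile t] by simp
  then have "continuous_on UNIV profile"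
    by (simp add: continuous_at_imp_continuous_on)
  moreover have "0 \<le> profile t" "profile t \<le> exp (\<mu> * t)"
    "exp (\<mu> * t) + q * exp (2 * \<mu> * t) \<le> profile t" for t
    using admissible_iterates
    by (auto simp: admissible_def intro!: tendsto_lowerbound[OF iterates_tendsto]
        tendsto_upperbound[OF iterates_tendsto])
  ultimately show ?thesis by (simp add: admissible_def)
qed

lemma profile_fixed_point: "profile = profile_op \<nu> z (delayed profile)"
proof
  fix t
  have "\<bar>profile_op \<nu> z (delayed profile) t - iterates (Suc n) t\<bar>
    \<le> rate ^ n * (rate * (- q / (1 - rate)) * exp (2 * \<mu> * t))" for n
    using profile_op_contraction[OF admissible_profile admissible_iterates profile_dist, of t n]
    by (simp add: mult_ac)
  then have "norm (iterates (Suc n) t - profile_op \<nu> z (delayed profile) t)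
    \<le> rate ^ n * (rate * (- q / (1 - rate)) * exp (2 * \<mu> * t))" for n
    by (metis real_norm_def abs_minus_commute)
  then have "(\<lambda>n. iterates (Suc n) t - profile_op \<nu> z (delayed profile) t) \<longlonglongrightarrow> 0"
    by (intro Lim_null_comparison[OF always_eventually rate_power_tendsto]) blast
  then have "(\<lambda>n. iterates (Suc n) t) \<longlonglongrightarrow> profile_op \<nu> z (delayed profile) t"
    by (simp add: LIM_zero_iff)
  moreover have "(\<lambda>n. iterates (Suc n) t) \<longlonglongrightarrow> profile t"
    by (rule LIMSEQ_Suc[OF iterates_tendsto])
  ultimately show "profile t = profile_op \<nu> z (delayed profile) t"
    using LIMSEQ_unique by blast
qed

end

section \<open>Elementary properties and approximate monotonicity of the profile\<close>

text \<open>The solutions are multiples of \<open>exp (k * t)\<close>, unbounded at +\<infinity>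
  unless zero. This serves as the uniqueness principle for bounded solutions of the averaging
  equation.\<close>

lemma deriv_proportional_bounded_eq_0:
  fixes D :: "real \<Rightarrow> real"
  assumes k: "k > 0" and D: "\<And>t. (D has_real_derivative k * D t) (at t)" and M: "\<And>t. \<bar>D t\<bar> \<le> M"
  shows "D t = 0"
proof -
  have "((\<lambda>t. exp (- k * t) * D t) has_real_derivative 0) (at u)" for u
    by (rule derivative_eq_intros D refl | simp)+
  then have const: "exp (- k * u) * D u = exp (- k * t) * D t" for u
    by (rule DERIV_isconst_all[rule_format])
  have "filterlim (\<lambda>u. - k * u) at_bot at_top"
    by (rule filterlim_tendsto_neg_mult_at_bot[OF tendsto_const _ filterlim_ident]) (use k in simp)
  then have "((\<lambda>u. M * exp (- k * u)) \<longlongrightarrow> 0) at_top"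
    by (intro tendsto_mult_right_zero filterlim_compose[OF exp_at_bot])
  moreover have "\<bar>exp (- k * t) * D t\<bar> \<le> M * exp (- k * u)" for u
    unfolding const[of u, symmetric] using M[of u] by (simp add: abs_mult mult.commute)
  ultimately have "\<bar>exp (- k * t) * D t\<bar> \<le> 0"
    by (intro tendsto_lowerbound[of _ 0]) auto
  then show ?thesis by simp
qed

text \<open>Both sides are bounded solutions of the same linear first-order equation, so their
  difference satisfies D' = k D and vanishes; no change of variables on a half-line is made.\<close>

lemma avg_shift:
  assumes F: "F \<in> bcontfun" and k: "k > 0"
  shows "avg k (\<lambda>s. F (s + h)) t = avg k F (t + h)"
proof -
  have Fh: "(\<lambda>s. F (s + h)) \<in> bcontfun"
    by (rule bcontfun_compose[OF F]) (intro continuous_intros)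
  let ?D = "\<lambda>t. avg k (\<lambda>s. F (s + h)) t - avg k F (t + h)"
  obtain M1 where M1: "\<And>t. \<bar>avg k (\<lambda>s. F (s + h)) t\<bar> \<le> M1"
    using bcontfun_boundE[OF avg_bcontfun[OF Fh k]] by blast
  obtain M2 where M2: "\<And>t. \<bar>avg k F t\<bar> \<le> M2"
    using bcontfun_boundE[OF avg_bcontfun[OF F k]] by blast
  have d: "((\<lambda>t. avg k F (t + h)) has_real_derivative k * (avg k F (t + h) - F (t + h))) (at t)" for t
    using avg_deriv[OF F k, of "t + h"] by (simp add: DERIV_shift)
  have "?D t = 0"
  proof (rule deriv_proportional_bounded_eq_0[OF k, where D = ?D and M = "M1 + M2"])
    show "(?D has_real_derivative k * ?D t) (at t)" for t
      using DERIV_diff[OF avg_deriv[OF Fh k, of t] d[of t]] by (simp add: algebra_simps)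
    show "\<bar>?D t\<bar> \<le> M1 + M2" for t
      using M1[of t] M2[of "t + h"] by linarith
  qed
  then show ?thesis by simp
qed

lemma profile_op_shift:
  assumes F: "F \<in> bcontfun" and "\<nu> > 0" "z > 0"
  shows "profile_op \<nu> z (\<lambda>s. F (s + h)) t = profile_op \<nu> z F (t + h)"
proof -
  have "(\<lambda>s. avg z (\<lambda>s. F (s + h)) (- s)) = (\<lambda>s. avg z F (- (s + - h)))"
    using avg_shift[OF F assms(3)] by simp
  note e = this avg_shift[OF bcontfun_reflect[OF avg_bcontfun[OF F assms(3)]] assms(2), of "- h" "- t"]
  have "- t + - h = - (t + h)" by simp
  then show ?thesis
    unfolding profile_op_def past_def e by (rule arg_cong)
qed

text \<open>The backward average damps a large rate \<open>l\<close> by at least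
  \<open>1 / l\<close>, while the forward average costs at most a factor 2 as long as
  \<open>l\<close> stays below half of \<open>z\<close>.\<close>

lemma gain_le:
  assumes "0 < \<nu>" "\<nu> \<le> 1" "0 < l" "2 * l \<le> z"
  shows "gain \<nu> z l \<le> 2 / l" "0 \<le> gain \<nu> z l" "z / (z - l) \<le> 2"
proof -
  show 1: "z / (z - l) \<le> 2" using assms by (simp add: field_simps)
  have "\<nu> * l \<le> \<nu> + l" using assms mult_right_mono[of \<nu> 1 l] by linarith
  then have "\<nu> / (\<nu> + l) \<le> 1 / l" using assms by (simp add: field_simps)
  then have "\<nu> / (\<nu> + l) * (z / (z - l)) \<le> 1 / l * 2"
    using 1 assms by (intro mult_mono) auto
  then show "gain \<nu> z l \<le> 2 / l" by (simp add: gain_def)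
  show "0 \<le> gain \<nu> z l" using assms by (simp add: gain_def)
qed

text \<open>At the first time with nonpositive derivative, \<open>f\<close> would still be
  nondecreasing up to that time, and \<open>step\<close> would make the derivative positive there.
  This justifies estimates that presuppose monotonicity up to the present.\<close>

lemma deriv_pos_continuation:
  fixes f' :: "real \<Rightarrow> real"
  assumes f: "\<And>t. (f has_real_derivative f' t) (at t)" and cont: "continuous_on UNIV f'"
    and step: "\<And>t. a \<le> t \<Longrightarrow> (\<And>s u. a \<le> s \<Longrightarrow> s \<le> u \<Longrightarrow> u \<le> t \<Longrightarrow> f s \<le> f u) \<Longrightarrow> f' t > 0"
    and "a \<le> t"
  shows "f' t > 0"
proof (rule ccontr)
  define S where "S = {a..t} \<inter> {u. f' u \<le> 0}"
  assume "\<not> f' t > 0"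
  then have "S \<noteq> {}" using assms(4) by (auto simp: S_def intro!: exI[of _ t])
  moreover have "closed S"
    unfolding S_def by (intro closed_Int closed_Collect_le cont continuous_intros)
  moreover have bdd: "bdd_below S" unfolding S_def by auto
  ultimately have m: "Inf S \<in> S" by (intro closed_contains_Inf)
  have pos: "f' u > 0" if "a \<le> u" "u < Inf S" for u
    using cInf_lower[OF _ bdd, of u] that m by (force simp: S_def)
  have "f' (Inf S) > 0"
  proof (rule step)
    show "a \<le> Inf S" using m by (simp add: S_def)
    fix s u assume "a \<le> s" "s \<le> u" "u \<le> Inf S"
    then show "f s \<le> f u"
    proof (cases "s = u")
      case False
      with \<open>s \<le> u\<close> have "s < u" by simp
      have "f s < f u"
      proof (rule DERIV_pos_imp_increasing_open[OF \<open>s < u\<close>])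
        fix v assume "s < v" "v < u"
        then show "\<exists>d. (f has_real_derivative d) (at v) \<and> d > 0"
          using f pos[of v] \<open>a \<le> s\<close> \<open>u \<le> Inf S\<close> by (intro exI[of _ "f' v"]) auto
      next
        show "continuous_on {s..u} f"
          by (meson DERIV_continuous_on f has_field_derivative_at_within)
      qed
      then show ?thesis by simp
    qed simp
  qed
  then show False using m by (simp add: S_def)
qed

context wave_params
begin

section \<open>Positivity, bounds and behaviour at minus infinity\<close>

definition "forcing = avg z (delayed profile)"

lemmas delayed_profile_bcontfun = delayed_bcontfun[OF admissible_profile]

lemma profile_cont: "continuous_on A profile"
  using admissible_profile continuous_on_subset by (auto simp: admissible_def)

lemma profile_nonneg: "0 \<le> profile t"
  and profile_le_exp: "profile t \<le> exp (\<mu> * t)"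
  and profile_ge_exp: "exp (\<mu> * t) + q * exp (2 * \<mu> * t) \<le> profile t"
  using admissible_profile by (auto simp: admissible_def)

lemma profile_le_1: "t \<le> 0 \<Longrightarrow> profile t \<le> 1"
  using profile_le_exp[of t] mu by (smt (verit) exp_le_one_iff mult_nonneg_nonpos)

lemma profile_deriv: "(profile has_real_derivative \<nu> * (forcing t - profile t)) (at t)"
  using past_deriv[OF avg_bcontfun[OF delayed_profile_bcontfun z0] nu(1), of t]
  by (subst (1 2) profile_fixed_point) (simp add: forcing_def profile_op_def[abs_def])

lemma forcing_deriv: "(forcing has_real_derivative z * (forcing t - delayed profile t)) (at t)"
  unfolding forcing_def by (rule avg_deriv[OF delayed_profile_bcontfun z0])

lemma forcing_cont: "continuous_on A forcing"
  by (meson DERIV_continuous_on forcing_deriv has_field_derivative_at_within)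

lemma forcing_bounds: "0 \<le> forcing t" "forcing t \<le> p"
  unfolding forcing_def
  using avg_const_bounds[OF delayed_profile_bcontfun z0] delayed_bounds[OF admissible_profile] by auto

lemma profile_le_p: "profile t \<le> p"
  using profile_op_le[OF nu(1) z0 delayed_profile_bcontfun, of 0 0 p 0 0 t] nu z0
    delayed_bounds[OF admissible_profile] profile_fixed_point by simp

text \<open>The lower barrier is positive far to the left, and
  \<open>exp (\<nu> * t) * profile t\<close> is nondecreasing because \<open>forcing\<close> is
  nonnegative, so positivity spreads to the right.\<close>

lemma profile_pos: "profile t > 0"
proof -
  have "((\<lambda>s. 1 + q * exp (\<mu> * s)) \<longlongrightarrow> 1 + q * 0) at_bot"
    using mu by (intro tendsto_intros filterlim_compose[OF exp_at_bot]
        filterlim_tendsto_pos_mult_at_bot[OF tendsto_const] filterlim_ident) auto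
  then have "\<forall>\<^sub>F s in at_bot. 0 < 1 + q * exp (\<mu> * s)"
    by (rule order_tendstoD) simp
  then have "\<forall>\<^sub>F s in at_bot. s \<le> t \<and> 0 < 1 + q * exp (\<mu> * s)"
    using eventually_conj[OF eventually_le_at_bot] by blast
  then obtain s where s: "s \<le> t" "0 < 1 + q * exp (\<mu> * s)"
    using eventually_happens by force
  have "0 < exp (\<mu> * s) * (1 + q * exp (\<mu> * s))" using s by simp
  also have "\<dots> = exp (\<mu> * s) + q * exp (2 * \<mu> * s)"
    by (simp add: algebra_simps flip: exp_add)
  also have "\<dots> \<le> profile s" by (rule profile_ge_exp)
  finally have "0 < exp (\<nu> * s) * profile s" by simp
  also have "\<dots> \<le> exp (\<nu> * t) * profile t"
  proof (rule DERIV_nonneg_imp_nondecreasing[OF s(1)])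
    fix u
    have "((\<lambda>u. exp (\<nu> * u) * profile u) has_real_derivative \<nu> * exp (\<nu> * u) * forcing u) (at u)"
      by (rule derivative_eq_intros profile_deriv refl | simp add: algebra_simps)+
    then show "\<exists>d. ((\<lambda>u. exp (\<nu> * u) * profile u) has_real_derivative d) (at u) \<and> 0 \<le> d"
      using nu forcing_bounds by (auto intro!: exI)
  qed
  finally show ?thesis by (simp add: zero_less_mult_iff)
qed

lemma profile_tendsto_0: "(profile \<longlongrightarrow> 0) at_bot"
proof (rule tendsto_sandwich[of "\<lambda>_. 0"])
  show "((\<lambda>t. exp (\<mu> * t)) \<longlongrightarrow> 0) at_bot"
    using mu by (intro filterlim_compose[OF exp_at_bot]
        filterlim_tendsto_pos_mult_at_bot[OF tendsto_const] filterlim_ident) auto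
qed (auto simp: profile_nonneg profile_le_exp)

text \<open>By \<open>char\<close>, the leading exponential of \<open>forcing\<close> has
  coefficient \<open>1 + \<mu> / \<nu>\<close>. The surplus \<open>\<mu> / \<nu>\<close> over the
  coefficient 1 of \<open>profile\<close> dominates the correction of rate 2\<mu> far to the
  left.\<close>

lemma profile_eventually_increasing: "\<exists>T. mono_on {..T} profile"
proof -
  let ?B = "(1 - q) * p * exp (- 2 * \<mu> * \<tau>) * (z / (z - 2 * \<mu>))"
  have "((\<lambda>s. \<mu> / \<nu> - ?B * exp (\<mu> * s)) \<longlongrightarrow> \<mu> / \<nu> - ?B * 0) at_bot"
    using mu by (intro tendsto_intros filterlim_compose[OF exp_at_bot]
        filterlim_tendsto_pos_mult_at_bot[OF tendsto_const] filterlim_ident) auto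
  then have "\<forall>\<^sub>F s in at_bot. 0 < \<mu> / \<nu> - ?B * exp (\<mu> * s)"
    by (rule order_tendstoD(1)) (use mu nu in simp)
  then obtain T where T: "\<And>s. s \<le> T \<Longrightarrow> 0 < \<mu> / \<nu> - ?B * exp (\<mu> * s)"
    by (auto simp: eventually_at_bot_linorder)
  have incr: "profile s \<le> forcing s" if "s \<le> T" for s
  proof -
    have "forcing s \<ge> 0 + p * exp (- \<mu> * \<tau>) * (z / (z - \<mu>)) * exp (\<mu> * s)
      + (q - 1) * p * exp (- 2 * \<mu> * \<tau>) * (z / (z - 2 * \<mu>)) * exp (2 * \<mu> * s)"
      unfolding forcing_def using mu z0 delayed_ge_exp[OF admissible_profile]
      by (intro avg_ge delayed_profile_bcontfun) auto
    also have "p * exp (- \<mu> * \<tau>) * (z / (z - \<mu>)) = 1 + \<mu> / \<nu>"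
    proof -
      have "p * exp (- \<mu> * \<tau>) * (z / (z - \<mu>)) = p * exp (- \<mu> * \<tau>) * gain \<nu> z \<mu> * ((\<nu> + \<mu>) / \<nu>)"
        using nu mu by (simp add: gain_def)
      then show ?thesis unfolding char using nu by (simp add: field_simps)
    qed
    also have "0 + (1 + \<mu> / \<nu>) * exp (\<mu> * s)
        + (q - 1) * p * exp (- 2 * \<mu> * \<tau>) * (z / (z - 2 * \<mu>)) * exp (2 * \<mu> * s)
      = exp (\<mu> * s) + exp (\<mu> * s) * (\<mu> / \<nu> - ?B * exp (\<mu> * s))"
    proof -
      have "exp (2 * \<mu> * s) = exp (\<mu> * s) * exp (\<mu> * s)" by (simp flip: exp_add)
      then show ?thesis by (simp only:) (simp add: algebra_simps)
    qed
    finally show ?thesis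
      using profile_le_exp[of s] T[OF that] by (smt (verit) exp_gt_zero mult_pos_pos)
  qed
  have "mono_on {..T} profile"
  proof (rule mono_onI)
    fix r s assume "r \<in> {..T}" "s \<in> {..T}" "r \<le> s"
    then show "profile r \<le> profile s"
      using profile_deriv incr nu
      by (intro DERIV_nonneg_imp_nondecreasing[of r s profile]) (force intro!: mult_nonneg_nonneg)+
  qed
  then show ?thesis ..
qed

lemma profile_lipschitz: "\<bar>profile t - profile s\<bar> \<le> p * \<bar>t - s\<bar>"
proof -
  have "norm (\<nu> * (forcing u - profile u)) \<le> p" for u
  proof -
    have "\<bar>forcing u - profile u\<bar> \<le> p"
      using forcing_bounds[of u] profile_nonneg[of u] profile_le_p[of u] by linarith
    then have "\<nu> * \<bar>forcing u - profile u\<bar> \<le> 1 * p" using nu by (intro mult_mono) auto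
    then show ?thesis using nu by (simp add: abs_mult)
  qed
  from field_differentiable_bound[of UNIV profile, OF _ has_field_derivative_at_within[OF profile_deriv] this, of t s]
  show ?thesis by simp
qed

text \<open>The nonlinearity increases on \<open>{0..1}\<close>, so only arguments beyond time \<open>\<tau>\<close> can spoil monotonicity on
  \<open>{..\<tau>}\<close>; they are reached only through the thin tail of the forward average. The induction pushes the
  initial defect, of order \<open>exp (2 * \<mu> * t)\<close>, through the contraction.\<close>

lemma profile_almost_mono:
  assumes l: "4 * p \<le> l" "2 * l \<le> z" and st: "s \<le> t" "t \<le> \<tau>"
  shows "profile s \<le> profile t + 4 * p / l"
proof -
  define h where "h = t - s"
  define k where "k = p * exp (- l * \<tau>) * gain \<nu> z l"
  \<comment> \<open>Chosen so that \<open>(N + 1) * k = N\<close>: an induction step turns the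
    coefficient \<open>N\<close> into \<open>(N + 1) * k\<close>, the extra 1 coming from the crude
    bound at times \<open>r + h > 0\<close>.\<close>
  define N where "N = k / (1 - k)"
  have h: "h \<ge> 0" using st by (simp add: h_def)
  have l0: "l > 0" using l p0 by linarith
  note g = gain_le[OF nu l0 l(2)]
  have "p * exp (- l * \<tau>) * gain \<nu> z l \<le> p * 1 * (2 / l)"
    using p0 g l0 tau by (intro mult_mono) auto
  moreover have "p * 1 * (2 / l) \<le> 1 / 2" using l l0 by (simp add: field_simps)
  ultimately have k: "0 \<le> k" "k \<le> 1 / 2" using p0 g by (auto simp: k_def)
  have N0: "N \<ge> 0" using k by (simp add: N_def)
  have N: "(N + 1) * k = N" using k by (simp add: N_def field_simps)
  have bound: "profile r - profile (r + h)
    \<le> rate ^ n * (- q * exp (2 * \<mu> * h)) * exp (2 * \<mu> * r) + N * exp (l * (r + h))" for n r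
  proof (induction n arbitrary: r)
    case 0
    have "exp (\<mu> * r) \<le> exp (\<mu> * (r + h))" using mu h by (simp add: mult_left_mono)
    moreover have "exp (2 * \<mu> * (r + h)) = exp (2 * \<mu> * h) * exp (2 * \<mu> * r)"
      by (simp add: algebra_simps flip: exp_add)
    moreover have "N * exp (l * (r + h)) \<ge> 0" using N0 by simp
    ultimately show ?case
      using profile_le_exp[of r] profile_ge_exp[of "r + h"] unfolding power_0
      by (simp only: mult_1 mult_minus_left mult.assoc)
  next
    case (Suc n)
    let ?c = "rate ^ n * (- q * exp (2 * \<mu> * h))"
    have c0: "?c \<ge> 0" using rate_pos q_neg by (simp add: mult_nonneg_nonpos mult_nonpos_nonneg)
    have step: "nich p (profile r) - nich p (profile (r + h))
      \<le> p * ?c * exp (2 * \<mu> * r) + p * (N + 1) * exp (l * (r + h))" for r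
    proof (cases "r + h \<le> 0")
      case True
      have r: "r \<le> 0" using True h by simp
      show ?thesis
      \<comment> \<open>While both values are at most 1, the nonlinearity preserves a correct order;
        only a defect is passed on, with factor \<open>p\<close>.\<close>
      proof (cases "profile r \<le> profile (r + h)")
        case True
        then have "nich p (profile r) \<le> nich p (profile (r + h))"
          using nich_mono[OF p0 profile_nonneg] profile_le_1[OF \<open>r + h \<le> 0\<close>] by simp
        moreover have "0 \<le> p * ?c * exp (2 * \<mu> * r)"
          by (intro mult_nonneg_nonneg[OF mult_nonneg_nonneg] c0) (use p0 in auto)
        moreover have "0 \<le> p * (N + 1) * exp (l * (r + h))"
          using p0 N0 by simp
        ultimately show ?thesis by linarith
      next
        case False
        then have "nich p (profile r) - nich p (profile (r + h)) \<le> p * (profile r - profile (r + h))"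
          using nich_lipschitz[OF p0 profile_nonneg profile_nonneg, of r "r + h"] by simp
        also have "\<dots> \<le> p * (?c * exp (2 * \<mu> * r) + N * exp (l * (r + h)))"
          using p0 by (intro mult_left_mono Suc.IH) auto
        also have "\<dots> \<le> p * ?c * exp (2 * \<mu> * r) + p * (N + 1) * exp (l * (r + h))"
          using p0 by (simp add: algebra_simps)
        finally show ?thesis .
      qed
    next
      case False
      \<comment> \<open>Here the order of the values is unknown, and the crude bound
        \<open>p\<close> is charged to the exponential of rate \<open>l\<close>.\<close>
      then have "1 \<le> exp (l * (r + h))" using l0 by simp
      then have "p * 1 * 1 \<le> p * (N + 1) * exp (l * (r + h))"
        using p0 N0 by (intro mult_mono) auto
      moreover have "nich p (profile r) \<le> p" "0 \<le> nich p (profile (r + h))"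
        using nich_le[OF p0] nich_nonneg[OF p0 profile_nonneg] by auto
      moreover have "0 \<le> p * ?c * exp (2 * \<mu> * r)"
        by (intro mult_nonneg_nonneg[OF mult_nonneg_nonneg] c0) (use p0 in auto)
      ultimately show ?thesis by linarith
    qed
    have le: "delayed profile s - delayed profile (s + h)
      \<le> 0 + (p * ?c * exp (- 2 * \<mu> * \<tau>)) * exp (2 * \<mu> * s)
        + (p * (N + 1) * exp (- l * \<tau>) * exp (l * h)) * exp (l * s)" for s
      using step[of "s - \<tau>"] by (simp add: delayed_def algebra_simps flip: exp_add)
    have sh: "(\<lambda>s. delayed profile (s + h)) \<in> bcontfun"
      by (rule bcontfun_compose[OF delayed_profile_bcontfun]) (intro continuous_intros)
    have "profile r - profile (r + h)
      = profile_op \<nu> z (\<lambda>s. delayed profile s - delayed profile (s + h)) r"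
      using profile_op_diff[OF nu(1) z0 delayed_profile_bcontfun sh]
        profile_op_shift[OF delayed_profile_bcontfun nu(1) z0] profile_fixed_point by simp
    also have "\<dots> \<le> 0 + (p * ?c * exp (- 2 * \<mu> * \<tau>)) * gain \<nu> z (2 * \<mu>) * exp (2 * \<mu> * r)
        + (p * (N + 1) * exp (- l * \<tau>) * exp (l * h)) * gain \<nu> z l * exp (l * r)"
      using nu mu l l0 le
      by (intro profile_op_le[OF nu(1) z0] bcontfun_diff delayed_profile_bcontfun sh) auto
    also have "\<dots> = rate * ?c * exp (2 * \<mu> * r) + ((N + 1) * k) * exp (l * (r + h))"
      by (simp add: rate_def k_def distrib_left exp_add mult_ac)
    finally show ?case by (simp only: N power_Suc mult.assoc)
  qed
  have "(\<lambda>n. rate ^ n * (- q * exp (2 * \<mu> * h) * exp (2 * \<mu> * s)) + N * exp (l * t))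
    \<longlonglongrightarrow> 0 + N * exp (l * t)"
    by (intro tendsto_intros rate_power_tendsto)
  then have "profile s - profile t \<le> 0 + N * exp (l * t)"
    by (rule tendsto_lowerbound) (use bound[of s] in \<open>auto simp: h_def mult.assoc\<close>)
  also have "\<dots> \<le> (2 * k) * exp (l * \<tau>)"
  proof -
    have "N \<le> 2 * k" using k by (simp add: N_def field_simps mult_left_le)
    then have "N * exp (l * t) \<le> (2 * k) * exp (l * \<tau>)"
      using k l0 st by (intro mult_mono) auto
    then show ?thesis by simp
  qed
  also have "\<dots> = 2 * p * gain \<nu> z l"
    by (simp add: k_def exp_minus)
  also have "\<dots> \<le> 4 * p / l"
    using mult_left_mono[OF g(1), of "2 * p"] p0 by simp
  finally show ?thesis by simp
qed

end

section \<open>Lower bound at time \<open>\<tau>\<close> and forward growth\<close>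

text \<open>The lower bound for the profile at time \<open>\<tau>\<close> in the limit of infinite speed, obtained from the subsolution
  \<open>exp (\<mu> * t) + q * exp (2 * \<mu> * t)\<close> on \<open>{-\<tau>..0}\<close>.\<close>

definition tau_bound :: "real \<Rightarrow> real \<Rightarrow> real \<Rightarrow> real \<Rightarrow> real \<Rightarrow> real" where
  "tau_bound \<tau> p \<nu> \<mu> q = exp (- \<nu> * \<tau>) * (1 + q + integral {0..\<tau>} (\<lambda>s. \<nu> * exp (\<nu> * s) *
    nich p (max 0 (exp (\<mu> * (s - \<tau>)) + q * exp (2 * \<mu> * (s - \<tau>))))))"

context wave_params
begin

text \<open>\<open>delayed profile\<close> has Lipschitz constant \<open>p\<^sup>2\<close>. Its
  drift is replaced by an exponential through \<open>l * (r - s) \<le> exp (l * (r - s))\<close>, on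
  which the forward average is explicit; the factor \<open>1 / l\<close> remains.\<close>

lemma forcing_ge_delayed:
  assumes l: "0 < l" "2 * l \<le> z"
  shows "forcing s \<ge> delayed profile s - 2 * p\<^sup>2 / l"
proof -
  have "delayed profile r \<ge> delayed profile s + - (p\<^sup>2 / l * exp (- l * s)) * exp (l * r) + 0 * exp (0 * r)"
    if "r \<ge> s" for r
  proof -
    have "\<bar>delayed profile s - delayed profile r\<bar> \<le> p * \<bar>profile (s - \<tau>) - profile (r - \<tau>)\<bar>"
      unfolding delayed_def by (rule nich_lipschitz[OF p0 profile_nonneg profile_nonneg])
    also have "\<dots> \<le> p * (p * \<bar>s - r\<bar>)"
      using profile_lipschitz[of "s - \<tau>" "r - \<tau>"] p0 by (intro mult_left_mono) auto
    also have "\<dots> = p\<^sup>2 / l * (l * (r - s))"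
      using that l by (simp add: power2_eq_square)
    also have "l * (r - s) \<le> exp (l * (r - s))"
      using exp_ge_add_one_self[of "l * (r - s)"] by linarith
    then have "p\<^sup>2 / l * (l * (r - s)) \<le> p\<^sup>2 / l * exp (l * (r - s))"
      using l by (intro mult_left_mono) auto
    also have "exp (l * (r - s)) = exp (- l * s) * exp (l * r)"
      by (simp add: algebra_simps flip: exp_add)
    finally show ?thesis by (simp add: abs_le_iff mult.assoc)
  qed
  from avg_ge[OF delayed_profile_bcontfun z0 _ _ this] l z0
  have "forcing s \<ge> delayed profile s
    + - (p\<^sup>2 / l * exp (- l * s)) * (z / (z - l)) * exp (l * s)"
    by (simp add: forcing_def)
  also have "- (p\<^sup>2 / l * exp (- l * s)) * (z / (z - l)) * exp (l * s) = - (p\<^sup>2 / l * (z / (z - l)))"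
    by (simp add: exp_minus)
  finally have "forcing s \<ge> delayed profile s - p\<^sup>2 / l * (z / (z - l))" by simp
  moreover have "p\<^sup>2 / l * (z / (z - l)) \<le> p\<^sup>2 / l * 2"
    using gain_le(3)[OF nu l] l by (intro mult_left_mono) auto
  ultimately show ?thesis by simp
qed

text \<open>Variation of constants over {0..\<tau>}. The delayed times are nonpositive there, so the
  profile is at most 1, the nonlinearity increases, and the lower barrier may be inserted for the
  profile.\<close>

lemma profile_tau_ge:
  assumes l: "0 < l" "2 * l \<le> z"
  shows "profile \<tau> \<ge> tau_bound \<tau> p \<nu> \<mu> q - 2 * p\<^sup>2 / l"
proof -
  let ?c = "2 * p\<^sup>2 / l"
  \<comment> \<open>Adding one constant to both \<open>profile\<close> and \<open>forcing\<close>
    preserves the differential equation, so the error needs no integral of its own.\<close>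
  let ?H = "\<lambda>s. exp (\<nu> * s) * (profile s + ?c)"
  let ?m = "\<lambda>s. max 0 (exp (\<mu> * (s - \<tau>)) + q * exp (2 * \<mu> * (s - \<tau>)))"
  have c: "?c \<ge> 0" using l by simp
  have H: "((\<lambda>s. \<nu> * exp (\<nu> * s) * (forcing s + ?c)) has_integral (?H \<tau> - ?H 0)) {0..\<tau>}"
  proof (rule fundamental_theorem_of_calculus)
    fix s
    have "(?H has_real_derivative \<nu> * exp (\<nu> * s) * (forcing s + ?c)) (at s)"
      by (rule derivative_eq_intros profile_deriv refl | simp add: algebra_simps)+
    then show "(?H has_vector_derivative \<nu> * exp (\<nu> * s) * (forcing s + ?c)) (at s within {0..\<tau>})"
      by (simp add: has_real_derivative_iff_has_vector_derivative has_vector_derivative_at_within)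
  qed (use tau in simp)
  have "integral {0..\<tau>} (\<lambda>s. \<nu> * exp (\<nu> * s) * nich p (?m s)) \<le> ?H \<tau> - ?H 0"
  proof (rule has_integral_le[OF integrable_integral H])
    show "(\<lambda>s. \<nu> * exp (\<nu> * s) * nich p (?m s)) integrable_on {0..\<tau>}"
      by (intro integrable_continuous_interval continuous_intros)
    fix s assume s: "s \<in> {0..\<tau>}"
    have "?m s \<le> profile (s - \<tau>)"
      using profile_nonneg[of "s - \<tau>"] profile_ge_exp[of "s - \<tau>"] by simp
    then have "nich p (?m s) \<le> delayed profile s"
      unfolding delayed_def using profile_le_1[of "s - \<tau>"] s by (intro nich_mono[OF p0]) auto
    then have "nich p (?m s) \<le> forcing s + ?c" using forcing_ge_delayed[OF l, of s] by simp
    then show "\<nu> * exp (\<nu> * s) * nich p (?m s) \<le> \<nu> * exp (\<nu> * s) * (forcing s + ?c)"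
      using nu by (intro mult_left_mono) auto
  qed
  moreover have "1 + q \<le> profile 0" using profile_ge_exp[of 0] by simp
  ultimately have "1 + q + integral {0..\<tau>} (\<lambda>s. \<nu> * exp (\<nu> * s) * nich p (?m s)) \<le> ?H \<tau>"
    using c by simp
  then have "tau_bound \<tau> p \<nu> \<mu> q \<le> exp (- \<nu> * \<tau>) * ?H \<tau>"
    unfolding tau_bound_def by (intro mult_left_mono) auto
  also have "\<dots> = profile \<tau> + ?c" by (simp add: exp_minus)
  finally show ?thesis by simp
qed

text \<open>\<open>profile \<tau>\<close> is an average of \<open>delayed profile\<close>. Up to
  time \<tau> the delayed arguments are nonpositive, where almost-monotonicity makes the value at 0
  nearly the largest; the rest is tail. An overshoot at \<tau> therefore already shows in the
  feedback of \<open>profile 0\<close>.\<close>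

lemma nich_profile_0_ge:
  assumes l: "4 * p \<le> l" "2 * l \<le> z"
  shows "nich p (profile 0) \<ge> profile \<tau> - 4 * p\<^sup>2 / l - 2 * p / l"
proof -
  have l0: "l > 0" using l p0 by linarith
  let ?X = "nich p (profile 0) + p * (4 * p / l)"
  have X0: "?X \<ge> 0" using nich_nonneg[OF p0 profile_nonneg] p0 l0 by simp
  have "delayed profile s \<le> ?X + p * exp (- l * \<tau>) * exp (l * s) + 0 * exp (0 * s)" for s
  proof (cases "s \<le> \<tau>")
    case True
    have *: "profile (s - \<tau>) \<le> profile 0 + 4 * p / l"
      using profile_almost_mono[OF l, of "s - \<tau>" 0] True tau by simp
    have "delayed profile s \<le> ?X"
    proof (cases "profile (s - \<tau>) \<le> profile 0")
      case True
      then have "delayed profile s \<le> nich p (profile 0)"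
        unfolding delayed_def using nich_mono[OF p0 profile_nonneg] profile_le_1[of 0] by simp
      then show ?thesis using p0 l0 by (simp add: add_increasing2)
    next
      case False
      have "delayed profile s - nich p (profile 0) \<le> p * (profile (s - \<tau>) - profile 0)"
        using nich_lipschitz[OF p0 profile_nonneg profile_nonneg, of "s - \<tau>" 0] False
        by (simp add: delayed_def)
      also have "\<dots> \<le> p * (4 * p / l)" using * p0 by (intro mult_left_mono) auto
      finally show ?thesis by simp
    qed
    then show ?thesis using p0 by (simp add: add_increasing2)
  next
    case False
    then have "p * 1 \<le> p * exp (l * (s - \<tau>))" using l0 p0 by (intro mult_left_mono) auto
    also have "\<dots> = p * exp (- l * \<tau>) * exp (l * s)" by (simp add: algebra_simps flip: exp_add)
    finally show ?thesis using delayed_bounds(2)[OF admissible_profile, of s] X0 by simp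
  qed
  then have "profile_op \<nu> z (delayed profile) \<tau>
    \<le> ?X + p * exp (- l * \<tau>) * gain \<nu> z l * exp (l * \<tau>) + 0 * gain \<nu> z 0 * exp (0 * \<tau>)"
    using l l0 nu z0 by (intro profile_op_le[OF nu(1) z0 delayed_profile_bcontfun]) auto
  also have "\<dots> = ?X + p * gain \<nu> z l" by (simp add: exp_minus)
  also have "\<dots> \<le> ?X + p * (2 / l)"
    using gain_le(1)[OF nu l0 l(2)] p0 by (intro add_left_mono mult_left_mono) auto
  finally show ?thesis unfolding profile_fixed_point[symmetric] by (simp add: power2_eq_square)
qed

text \<open>The equation is of mixed type; this bound on the future in terms of one delay interval of the past is
  what makes its advanced part negligible, of relative size \<open>exp (- l * \<tau>)\<close>.\<close>

lemma deviation_growth: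
  assumes w: "w = 4 * p + 4" "2 * w \<le> z"
    and h: "\<And>s. t - \<tau> \<le> s \<Longrightarrow> s \<le> t \<Longrightarrow> \<bar>profile s - ln p\<bar> \<le> h" and s: "t \<le> s"
  shows "\<bar>profile s - ln p\<bar> \<le> 3 * h * exp (w * (s - t))"
proof -
  let ?y = "\<lambda>s. profile s - ln p"
  let ?r = "\<lambda>s. \<bar>?y s\<bar> * exp (- w * (s - t))"
  \<comment> \<open>Boundedness of the profile makes this supremum finite, so that the
    self-referential estimate \<open>W \<le> 5 * h / 4 + W / 2\<close> obtained below can be solved
    for \<open>W\<close>.\<close>
  define W where "W = (SUP s\<in>{t..}. ?r s)"
  have w0: "w > 0" using w p0 by simp
  have h0: "h \<ge> 0" using h[of t] tau by simp
  have lnp: "0 \<le> ln p" "ln p \<le> p" using p1 ln_bound[of p] by auto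
  have y_le: "\<bar>?y s\<bar> \<le> p" for s using profile_nonneg[of s] profile_le_p[of s] lnp by linarith
  have bdd: "bdd_above (?r ` {t..})"
  proof (rule bdd_aboveI2)
    fix s assume "s \<in> {t..}"
    then show "?r s \<le> p * 1" using y_le w0 p0 by (intro mult_mono) auto
  qed
  have W: "\<bar>?y s\<bar> \<le> W * exp (w * (s - t))" if "t \<le> s" for s
  proof -
    have "?r s \<le> W" unfolding W_def using bdd that by (intro cSUP_upper) auto
    then have "?r s * exp (w * (s - t)) \<le> W * exp (w * (s - t))" by (intro mult_right_mono) auto
    moreover have "?r s * exp (w * (s - t)) = \<bar>?y s\<bar>" by (simp add: mult.assoc flip: exp_add)
    ultimately show ?thesis by (simp only:)
  qed
  have W0: "W \<ge> 0" using W[of t] by simp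
  let ?b = "p * h + (2 * p + 1) * W"
  have forcing_le: "\<bar>forcing s - ln p\<bar> \<le> p * h + 2 * p * W * exp (w * (s - t))" if "t \<le> s" for s
  proof -
    have F: "\<bar>delayed profile r - ln p\<bar> \<le> p * h + p * W * exp (- w * t) * exp (w * r)" if "s \<le> r" for r
    proof -
      have "\<bar>delayed profile r - ln p\<bar> \<le> p * \<bar>?y (r - \<tau>)\<bar>"
        using nich_lipschitz[OF p0 profile_nonneg lnp(1), of "r - \<tau>"]
        by (simp add: delayed_def nich_fixed_point[OF p0])
      also have "\<bar>?y (r - \<tau>)\<bar> \<le> h + W * exp (w * (r - t))"
      proof (cases "r - \<tau> \<le> t")
        case True
        then have "\<bar>?y (r - \<tau>)\<bar> \<le> h" using h \<open>t \<le> s\<close> \<open>s \<le> r\<close> by simp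
        then show ?thesis using W0 by (simp add: add_increasing2)
      next
        case False
        have "\<bar>?y (r - \<tau>)\<bar> \<le> W * exp (w * (r - \<tau> - t))" using W False by simp
        also have "\<dots> \<le> W * exp (w * (r - t))"
          using W0 w0 tau by (intro mult_left_mono) auto
        finally show ?thesis using h0 by simp
      qed
      then have "p * \<bar>?y (r - \<tau>)\<bar> \<le> p * (h + W * exp (w * (r - t)))"
        using p0 by (intro mult_left_mono) auto
      finally show ?thesis by (simp add: algebra_simps flip: exp_add)
    qed
    let ?e = "p * W * exp (- w * t) * (z / (z - w)) * exp (w * s)"
    have wz: "w < z" using w w0 by linarith
    have "delayed profile r \<le> (ln p + p * h) + p * W * exp (- w * t) * exp (w * r) + 0 * exp (0 * r)"
      if "s \<le> r" for r using F[OF that] by linarith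
    from avg_le[OF delayed_profile_bcontfun z0 wz z0 this]
    have "forcing s \<le> (ln p + p * h) + ?e + 0 * (z / (z - 0)) * exp (0 * s)"
      unfolding forcing_def by simp
    moreover have "delayed profile r
      \<ge> (ln p - p * h) + - (p * W * exp (- w * t)) * exp (w * r) + 0 * exp (0 * r)"
      if "s \<le> r" for r using abs_le_D2[OF F[OF that]] by simp
    from avg_ge[OF delayed_profile_bcontfun z0 wz z0 this]
    have "forcing s \<ge> (ln p - p * h) + - (p * W * exp (- w * t)) * (z / (z - w)) * exp (w * s)
        + 0 * (z / (z - 0)) * exp (0 * s)"
      unfolding forcing_def by simp
    ultimately have "\<bar>forcing s - ln p\<bar> \<le> p * h + ?e" by (simp add: abs_le_iff)
    also have "?e = p * W * exp (w * (s - t)) * (z / (z - w))"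
      by (simp add: algebra_simps flip: exp_add)
    also have "\<dots> \<le> p * W * exp (w * (s - t)) * 2"
      using gain_le(3)[OF nu w0 w(2)] p0 W0 by (intro mult_left_mono) auto
    finally show ?thesis by (simp add: mult_ac)
  qed
  have deriv_le: "\<bar>\<nu> * (forcing s - profile s)\<bar> \<le> ?b * exp (w * (s - t))" if "t \<le> s" for s
  proof -
    have e1: "1 \<le> exp (w * (s - t))" using that w0 by simp
    have "\<nu> * \<bar>forcing s - profile s\<bar> \<le> 1 * \<bar>forcing s - profile s\<bar>"
      using nu by (intro mult_right_mono) auto
    also have "\<dots> \<le> p * h + 2 * p * W * exp (w * (s - t)) + W * exp (w * (s - t))"
      using forcing_le[OF that] W[OF that] unfolding mult_1 by linarith
    also have "\<dots> \<le> ?b * exp (w * (s - t))"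
      using mult_left_mono[OF e1, of "p * h"] p0 h0 by (simp add: algebra_simps)
    finally show ?thesis using nu by (simp add: abs_mult)
  qed
  let ?E = "\<lambda>s. ?b / w * exp (w * (s - t))"
  have Ed: "(?E has_real_derivative ?b * exp (w * (s - t))) (at s)" for s
    using w0 by (auto intro!: derivative_eq_intros)
  have y_bound: "\<bar>?y s - ?y t\<bar> \<le> ?b / w * exp (w * (s - t))" if "t \<le> s" for s
  proof -
    have "?y t - ?E t \<ge> ?y s - ?E s"
    proof (rule DERIV_nonpos_imp_nonincreasing[OF that])
      fix u assume "t \<le> u"
      then show "\<exists>d. ((\<lambda>s. ?y s - ?E s) has_real_derivative d) (at u) \<and> d \<le> 0"
        using deriv_le[of u]
        by (intro exI[of _ "\<nu> * (forcing u - profile u) - 0 - ?b * exp (w * (u - t))"] conjI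
            DERIV_diff profile_deriv DERIV_const Ed) (auto simp: abs_le_iff)
    qed
    moreover have "?y t + ?E t \<le> ?y s + ?E s"
    proof (rule DERIV_nonneg_imp_nondecreasing[OF that])
      fix u assume "t \<le> u"
      then show "\<exists>d. ((\<lambda>s. ?y s + ?E s) has_real_derivative d) (at u) \<and> 0 \<le> d"
        using deriv_le[of u]
        by (intro exI[of _ "\<nu> * (forcing u - profile u) - 0 + ?b * exp (w * (u - t))"] conjI
            DERIV_add DERIV_diff profile_deriv DERIV_const Ed) (auto simp: abs_le_iff)
    qed
    moreover have "?E t \<ge> 0" using p0 h0 W0 w0 by simp
    ultimately show ?thesis by linarith
  qed
  have "(SUP s\<in>{t..}. ?r s) \<le> h + ?b / w"
  proof (rule cSUP_least)
    fix s assume "s \<in> {t..}"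
    then have ts: "t \<le> s" by simp
    have "\<bar>?y s\<bar> \<le> h + ?b / w * exp (w * (s - t))"
      using y_bound[OF ts] h[of t] tau by linarith
    also have "\<dots> \<le> (h + ?b / w) * exp (w * (s - t))"
      using mult_left_mono[of 1 "exp (w * (s - t))" h] h0 w0 ts by (simp add: algebra_simps)
    finally have "?r s \<le> ((h + ?b / w) * exp (w * (s - t))) * exp (- w * (s - t))"
      by (intro mult_right_mono) auto
    also have "\<dots> = h + ?b / w" by (simp add: mult.assoc flip: exp_add)
    finally show "?r s \<le> h + ?b / w" .
  qed simp
  then have "W \<le> h + ?b / w" unfolding W_def[symmetric] .
  \<comment> \<open>The value \<open>4 * p + 4\<close> of \<open>w\<close> is made for this: the
    coefficient of \<open>W\<close> becomes 1/2 and can be absorbed.\<close>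
  also have "?b / w \<le> h / 4 + W / 2"
  proof -
    have "?b \<le> (h / 4 + W / 2) * w" using h0 W0 by (simp add: w algebra_simps)
    then show ?thesis using w0 by (simp add: divide_le_eq)
  qed
  finally have "W \<le> 3 * h" using h0 by simp
  then have "W * exp (w * (s - t)) \<le> 3 * h * exp (w * (s - t))" by (intro mult_right_mono) auto
  then show ?thesis using W[OF s] by linarith
qed

end

section \<open>Overshoot and convergence\<close>

context wave_params
begin

text \<open>Propagates the cone condition ``\<open>y * exp (L * t)\<close> is increasing'' for \<open>y = profile - ln p\<close> and
  \<open>L = 1 + 1 / \<tau>\<close>. At the equilibrium the delayed feedback is at most \<open>(ln p - 1) * exp (L * \<tau>) * y\<close>, which is
  below \<open>y / \<tau>\<close> by the upper bound on \<open>p\<close>; the tangent bound on the nonlinearity needs \<open>ln p \<ge> 2\<close>.\<close>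

lemma profile_overshoots:
  assumes lnp: "ln p \<ge> 2" and d: "\<delta> > 0" and l: "4 * p + 4 \<le> l" "8 * p + 8 \<le> z" "2 * l \<le> z"
    and over: "profile \<tau> \<ge> ln p + \<delta>" and ld: "10 * p\<^sup>2 / l \<le> \<delta>"
    and cone: "1 + (ln p - 1) * (1 + 4 * p / l / \<delta>) * exp (\<tau> + 1)
      + 6 * p * (exp (\<tau> + 1) * (1 + p / \<delta>)) * exp (- l * \<tau>) < 1 + 1 / \<tau>"
    and t: "\<tau> \<le> t"
  shows "profile t > ln p"
proof -
  let ?y = "\<lambda>t. profile t - ln p"
  let ?a = "ln p - 1"
  define L where "L = 1 + 1 / \<tau>"
  define \<eta> where "\<eta> = 4 * p / l"
  \<comment> \<open>Crude bound for the deviation on one delay interval, relative to its present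
    value. Before \<tau> only the bound \<open>p\<close> is known;
    \<open>1 \<le> ?y \<tau> / \<delta>\<close> turns it into a multiple of
    \<open>?y \<tau>\<close>.\<close>
  define C where "C = exp (\<tau> + 1) * (1 + p / \<delta>)"
  \<comment> \<open>Feedback relative to \<open>?y t\<close>: \<open>exp (\<tau> + 1)\<close> is
    \<open>exp (L * \<tau>)\<close>, the largest drop over one delay that the cone permits. The
    factor \<open>1 + \<eta> / \<delta>\<close> covers times before \<tau>, where \<open>?y\<close>
    may exceed \<open>?y \<tau> \<ge> \<delta>\<close> by \<eta>.\<close>
  define \<alpha> where "\<alpha> = ?a * (1 + \<eta> / \<delta>) * exp (\<tau> + 1)"
  have l0: "l > 0" using l p0 by linarith
  have eta: "\<eta> > 0" using l0 p0 by (simp add: \<eta>_def)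
  have L: "L * \<tau> = \<tau> + 1" "L > 0" using tau by (simp_all add: L_def field_simps add_pos_pos)
  have a: "?a > 0" using lnp by simp
  have lnp_le: "ln p \<le> p" using ln_bound[OF p0] .
  have y_le: "\<bar>?y s\<bar> \<le> p" for s
    using profile_nonneg[of s] profile_le_p[of s] lnp lnp_le by (simp add: abs_le_iff)
  have C0: "C \<ge> 0" using p0 d by (simp add: C_def)
  have y\<tau>: "?y \<tau> \<ge> \<delta>" "?y \<tau> > 0" using over d by auto

  \<comment> \<open>The 10 in the hypothesis is 4 + 2 + 4: the two losses of
    \<open>nich_profile_0_ge\<close>, and the reserve \<open>p * \<eta>\<close> that pays for a dip
    of the profile by \<eta> below \<open>profile 0\<close>.\<close>
  have nich_0: "nich p (profile 0) \<ge> ln p + p * \<eta>"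
  proof -
    have "p * 1 \<le> p * p" using p1 by (intro mult_left_mono) auto
    then have "2 * p / l \<le> 2 * p\<^sup>2 / l"
      using l0 by (intro divide_right_mono) (auto simp: power2_eq_square)
    moreover have "10 * p\<^sup>2 / l = 4 * p\<^sup>2 / l + 2 * p\<^sup>2 / l + p * \<eta>"
      using l0 by (simp add: \<eta>_def field_simps power2_eq_square)
    moreover have "nich p (profile 0) \<ge> profile \<tau> - 4 * p\<^sup>2 / l - 2 * p / l"
      using l by (intro nich_profile_0_ge) auto
    ultimately show ?thesis using over ld by linarith
  qed

  have early: "nich p (profile r) \<ge> ln p - ?a * max 0 (?y r)" "?y r \<le> ?y \<tau> + \<eta>"
    if r: "0 \<le> r" "r \<le> \<tau>" for r
  proof -
    show "?y r \<le> ?y \<tau> + \<eta>"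
      using profile_almost_mono[of l r \<tau>] l r by (simp add: \<eta>_def)
    have r0: "profile 0 \<le> profile r + \<eta>"
      using profile_almost_mono[of l 0 r] l r by (simp add: \<eta>_def)
    show "nich p (profile r) \<ge> ln p - ?a * max 0 (?y r)"
    proof (cases "profile r \<le> ln p")
      case True
      have "nich p (profile r) \<ge> ln p"
      proof (cases "profile r < profile 0")
        case True
        then have "p * \<bar>profile 0 - profile r\<bar> \<le> p * \<eta>"
          using r0 p0 by (intro mult_left_mono) auto
        then show ?thesis
          using nich_lipschitz[OF p0 profile_nonneg profile_nonneg, of 0 r] nich_0 by linarith
      next
        case False
        show ?thesis
        proof (cases "profile r \<le> 1")
          case True
          then have "nich p (profile 0) \<le> nich p (profile r)"
            using nich_mono[OF p0 profile_nonneg] False by simp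
          moreover have "p * \<eta> \<ge> 0" using p0 eta by simp
          ultimately show ?thesis using nich_0 by linarith
        next
          case False
          then show ?thesis
            using nich_strict_antimono[OF p0, of "profile r" "ln p"] \<open>profile r \<le> ln p\<close>
              nich_fixed_point[OF p0] by (cases "profile r = ln p") auto
        qed
      qed
      then show ?thesis using a by (simp add: True)
    next
      case False
      then show ?thesis using nich_ge_tangent[OF p0 lnp, of "?y r"] by simp
    qed
  qed

  let ?Y = "\<lambda>t. exp (L * t) * ?y t"
  let ?Y' = "\<lambda>t. exp (L * t) * (\<nu> * (forcing t - profile t) + L * ?y t)"
  have Y: "(?Y has_real_derivative ?Y' t) (at t)" for t
    by (rule derivative_eq_intros profile_deriv refl | simp add: algebra_simps)+
  have Y'_pos: "?Y' t > 0"
    if t: "\<tau> \<le> t" and mono: "\<And>s u. \<tau> \<le> s \<Longrightarrow> s \<le> u \<Longrightarrow> u \<le> t \<Longrightarrow> ?Y s \<le> ?Y u" for t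
  proof -
    have exp_split: "exp (L * (t - s)) = exp (L * t) * exp (- L * s)" for s
      by (simp add: algebra_simps flip: exp_add)
    have Y_inv: "?y s = exp (- L * s) * ?Y s" for s
      by (simp add: mult.assoc[symmetric] flip: exp_add)
    have y_late: "?y s \<le> exp (L * (t - s)) * ?y t" if "\<tau> \<le> s" "s \<le> t" for s
    proof -
      have "exp (- L * s) * ?Y s \<le> exp (- L * s) * ?Y t"
        by (intro mult_left_mono mono that) auto
      then show ?thesis unfolding Y_inv[symmetric] exp_split by (simp only: mult_ac)
    qed
    have y_pos: "?y s > 0" if "\<tau> \<le> s" "s \<le> t" for s
    proof -
      have "0 < ?Y \<tau>" using y\<tau> by simp
      also have "\<dots> \<le> ?Y s" by (intro mono that) auto
      finally show ?thesis by (simp add: zero_less_mult_iff)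
    qed
    have yt: "?y t > 0" by (rule y_pos) (use t in auto)
    have exp_le: "exp (L * (t - s)) \<le> exp (\<tau> + 1)" if "t - \<tau> \<le> s" for s
    proof -
      have "L * (t - s) \<le> L * \<tau>" using that L by (intro mult_left_mono) auto
      then show ?thesis using L by simp
    qed
    have y_late': "?y s \<le> exp (\<tau> + 1) * ?y t" if "\<tau> \<le> s" "s \<le> t" "t - \<tau> \<le> s" for s
      using y_late[OF that(1,2)] mult_right_mono[OF exp_le[OF that(3)], of "?y t"] yt by linarith
    have y\<tau>_le: "?y \<tau> \<le> exp (\<tau> + 1) * ?y t" if "t - \<tau> \<le> \<tau>"
      using y_late'[of \<tau>] t that by simp
    have C1: "exp (\<tau> + 1) * ?y t \<le> C * ?y t"
      using yt p0 d unfolding C_def by (intro mult_right_mono) auto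
    have past: "\<bar>?y s\<bar> \<le> C * ?y t" if s: "t - \<tau> \<le> s" "s \<le> t" for s
    proof (cases "\<tau> \<le> s")
      case True
      then show ?thesis using y_late'[OF True s(2,1)] y_pos[OF True s(2)] C1 by linarith
    next
      case False
      have "1 * p \<le> ?y \<tau> / \<delta> * p" using y\<tau> d p0 by (intro mult_right_mono) auto
      also have "\<dots> = p / \<delta> * ?y \<tau>" by simp
      also have "\<dots> \<le> p / \<delta> * (exp (\<tau> + 1) * ?y t)"
        using y\<tau>_le s False p0 d by (intro mult_left_mono) auto
      also have "\<dots> \<le> C * ?y t"
        using yt by (simp add: C_def algebra_simps)
      finally show ?thesis using y_le[of s] by linarith
    qed
    have growth: "\<bar>?y s\<bar> \<le> 3 * (C * ?y t) * exp (l * (s - t))" if "t \<le> s" for s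
    proof -
      have "\<bar>?y s\<bar> \<le> 3 * (C * ?y t) * exp ((4 * p + 4) * (s - t))"
        using past l that by (intro deviation_growth) auto
      also have "\<dots> \<le> 3 * (C * ?y t) * exp (l * (s - t))"
        using C0 yt that l by (intro mult_left_mono) (auto intro!: mult_right_mono)
      finally show ?thesis .
    qed
    let ?c = "3 * p * (C * ?y t)"
    have c0: "?c \<ge> 0" using p0 C0 yt by simp
    have \<alpha>0: "\<alpha> * ?y t \<ge> 0" using a d yt eta by (simp add: \<alpha>_def)
    have "delayed profile s \<ge> (ln p - \<alpha> * ?y t) + - (?c * exp (- l * (\<tau> + t))) * exp (l * s) + 0 * exp (0 * s)"
      if s: "t \<le> s" for s
    proof -
      let ?r = "s - \<tau>"
      let ?e = "?c * exp (l * (?r - t))"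
      have e0: "?e \<ge> 0" using c0 by simp
      have "nich p (profile ?r) \<ge> ln p - \<alpha> * ?y t - ?e"
      \<comment> \<open>Delayed times after \<open>t\<close> are controlled by
        \<open>growth\<close>, at the price of \<open>exp (- l * \<tau>)\<close> after averaging;
        those in {\<tau>..t} by the cone, and those in {0..\<tau>} by \<open>early\<close>.\<close>
      proof (cases "t \<le> ?r")
        case True
        have "\<bar>nich p (profile ?r) - ln p\<bar> \<le> p * \<bar>?y ?r\<bar>"
          using nich_lipschitz[OF p0 profile_nonneg, of "ln p" ?r] lnp by (simp add: nich_fixed_point[OF p0])
        also have "\<dots> \<le> p * (3 * (C * ?y t) * exp (l * (?r - t)))"
          using growth[OF True] p0 by (intro mult_left_mono) auto
        finally show ?thesis using \<alpha>0 by (simp add: abs_le_iff mult.assoc mult.left_commute[of p])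
      next
        case False
        have "?a * max 0 (?y ?r) \<le> \<alpha> * ?y t \<and> nich p (profile ?r) \<ge> ln p - ?a * max 0 (?y ?r)"
        proof (cases "\<tau> \<le> ?r")
          case True
          have pos: "?y ?r > 0" using y_pos[OF True] False by simp
          have "?y ?r \<le> 1 * (exp (\<tau> + 1) * ?y t)"
            using y_late'[OF True] False s by simp
          also have "\<dots> \<le> (1 + \<eta> / \<delta>) * (exp (\<tau> + 1) * ?y t)"
            using yt eta d by (intro mult_right_mono) auto
          finally have "max 0 (?y ?r) \<le> (1 + \<eta> / \<delta>) * (exp (\<tau> + 1) * ?y t)"
            unfolding max_absorb2[OF less_imp_le[OF pos]] .
          then have "?a * max 0 (?y ?r) \<le> ?a * ((1 + \<eta> / \<delta>) * (exp (\<tau> + 1) * ?y t))"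
            using a by (intro mult_left_mono) auto
          then show ?thesis
            using nich_ge_tangent[OF p0 lnp, of "?y ?r"] pos by (simp add: \<alpha>_def mult_ac)
        next
          case F2: False
          have r: "0 \<le> ?r" "?r \<le> \<tau>" using s t F2 by auto
          have "\<eta> * 1 \<le> \<eta> * (?y \<tau> / \<delta>)" using y\<tau> d eta by (intro mult_left_mono) auto
          moreover have "(1 + \<eta> / \<delta>) * ?y \<tau> = ?y \<tau> + \<eta> * (?y \<tau> / \<delta>)"
            unfolding distrib_right by simp
          ultimately have "?y ?r \<le> (1 + \<eta> / \<delta>) * ?y \<tau>"
            using early(2)[OF r] by linarith
          also have "\<dots> \<le> (1 + \<eta> / \<delta>) * (exp (\<tau> + 1) * ?y t)"
            using y\<tau>_le s F2 eta d by (intro mult_left_mono) auto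
          finally have "?y ?r \<le> (1 + \<eta> / \<delta>) * (exp (\<tau> + 1) * ?y t)" .
          moreover have "0 \<le> (1 + \<eta> / \<delta>) * (exp (\<tau> + 1) * ?y t)"
            using eta d yt by (intro mult_nonneg_nonneg) auto
          ultimately have "max 0 (?y ?r) \<le> (1 + \<eta> / \<delta>) * (exp (\<tau> + 1) * ?y t)"
            by (simp only: max.bounded_iff)
          then have "?a * max 0 (?y ?r) \<le> ?a * ((1 + \<eta> / \<delta>) * (exp (\<tau> + 1) * ?y t))"
            using a by (intro mult_left_mono) auto
          then show ?thesis using early(1)[OF r] by (simp add: \<alpha>_def mult_ac)
        qed
        then show ?thesis using e0 by linarith
      qed
      moreover have "?e = ?c * exp (- l * (\<tau> + t)) * exp (l * s)"
        by (simp add: algebra_simps flip: exp_add)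
      ultimately show ?thesis by (simp add: delayed_def)
    qed
    from avg_ge[OF delayed_profile_bcontfun z0 _ z0 this]
    have "forcing t \<ge> (ln p - \<alpha> * ?y t) + - (?c * exp (- l * (\<tau> + t))) * (z / (z - l)) * exp (l * t)"
      using l l0 by (simp add: forcing_def)
    also have "- (?c * exp (- l * (\<tau> + t))) * (z / (z - l)) * exp (l * t)
      = - (?c * exp (- l * \<tau>) * (z / (z - l)))"
      by (simp add: algebra_simps flip: exp_add)
    finally have "forcing t \<ge> ln p - \<alpha> * ?y t - ?c * exp (- l * \<tau>) * (z / (z - l))" by simp
    moreover have "?c * exp (- l * \<tau>) * (z / (z - l)) \<le> ?c * exp (- l * \<tau>) * 2"
      using gain_le(3)[OF nu l0 l(3)] c0 by (intro mult_left_mono) auto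
    ultimately have f: "forcing t - profile t
      \<ge> - ((1 + \<alpha> + 6 * p * C * exp (- l * \<tau>)) * ?y t)" (is "_ \<ge> - ?B")
      by (simp add: algebra_simps)
    have "0 \<le> ?y t + \<alpha> * ?y t + ?c * exp (- l * \<tau>) * 2"
      by (intro add_nonneg_nonneg mult_nonneg_nonneg[OF mult_nonneg_nonneg[OF c0]] \<alpha>0)
        (use yt in auto)
    also have "\<dots> = ?B" by (simp add: algebra_simps)
    finally have B: "0 \<le> ?B" .
    have "\<nu> * ?B \<le> 1 * ?B" using nu B by (intro mult_right_mono) auto
    moreover have "\<nu> * (forcing t - profile t) \<ge> \<nu> * - ?B" using f nu by (intro mult_left_mono) auto
    moreover have "?B < L * ?y t"
      using cone yt by (intro mult_strict_right_mono) (simp_all add: \<alpha>_def C_def L_def \<eta>_def)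
    ultimately have "\<nu> * (forcing t - profile t) + L * ?y t > 0" by simp
    then show ?thesis by simp
  qed
  have pos: "?Y' s > 0" if "\<tau> \<le> s" for s
  proof (rule deriv_pos_continuation[where f = ?Y and f' = ?Y' and a = \<tau>, OF Y _ _ that])
    show "continuous_on UNIV ?Y'"
      by (intro continuous_intros forcing_cont profile_cont)
  qed (rule Y'_pos)
  have "?Y \<tau> \<le> ?Y t"
    using Y pos by (intro DERIV_nonneg_imp_nondecreasing[OF t]) (meson less_imp_le)
  moreover have "0 < ?Y \<tau>" using y\<tau> by simp
  ultimately have "0 < ?Y t" by linarith
  then show ?thesis by (simp add: zero_less_mult_iff)
qed

text \<open>Past \<open>T + \<tau>\<close> all delayed values exceed \<open>ln p \<ge> 1\<close>,
  where the nonlinearity decreases, so \<open>forcing\<close> is at most \<open>ln p\<close>. The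
  same bound makes \<open>exp (\<nu> * t) * (profile t - ln p)\<close> nonincreasing, hence the
  convergence is exponential.\<close>

lemma profile_decreasing_to_equilibrium:
  assumes lnp: "ln p \<ge> 1" and above: "\<And>t. T \<le> t \<Longrightarrow> profile t > ln p"
  shows "antimono_on {T + \<tau>..} profile" "(profile \<longlongrightarrow> ln p) at_top"
proof -
  let ?y = "\<lambda>t. profile t - ln p"
  have f: "forcing t \<le> ln p" if "T + \<tau> \<le> t" for t
    unfolding forcing_def
  proof (rule avg_const_bounds(1)[OF delayed_profile_bcontfun z0])
    fix s assume "t \<le> s"
    then have "ln p < profile (s - \<tau>)" using above that by simp
    then show "delayed profile s \<le> ln p"
      using nich_strict_antimono[OF p0 lnp] nich_fixed_point[OF p0] by (simp add: delayed_def less_imp_le)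
  qed
  show "antimono_on {T + \<tau>..} profile"
  proof (rule monotone_onI)
    fix r s assume r: "r \<in> {T + \<tau>..}" and "s \<in> {T + \<tau>..}" and rs: "r \<le> s"
    show "profile s \<le> profile r"
    proof (rule DERIV_nonpos_imp_nonincreasing[OF rs])
      fix u assume "r \<le> u"
      then have "forcing u \<le> profile u" using f[of u] above[of u] r tau by simp
      then show "\<exists>d. (profile has_real_derivative d) (at u) \<and> d \<le> 0"
        using profile_deriv nu by (intro exI conjI) (auto simp: mult_le_0_iff)
    qed
  qed
  have decay: "?y t \<le> exp (\<nu> * (T + \<tau>)) * ?y (T + \<tau>) * exp (- \<nu> * t)" if "T + \<tau> \<le> t" for t
  proof -
    have "exp (\<nu> * t) * ?y t \<le> exp (\<nu> * (T + \<tau>)) * ?y (T + \<tau>)"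
    proof (rule DERIV_nonpos_imp_nonincreasing[OF that])
      fix u assume u: "T + \<tau> \<le> u"
      have "((\<lambda>t. exp (\<nu> * t) * ?y t) has_real_derivative \<nu> * exp (\<nu> * u) * (forcing u - ln p)) (at u)"
        by (rule derivative_eq_intros profile_deriv refl | simp add: algebra_simps)+
      then show "\<exists>d. ((\<lambda>t. exp (\<nu> * t) * ?y t) has_real_derivative d) (at u) \<and> d \<le> 0"
        using f[OF u] nu by (intro exI conjI) (auto simp: mult_le_0_iff)
    qed
    then have "exp (\<nu> * t) * ?y t * exp (- \<nu> * t)
      \<le> exp (\<nu> * (T + \<tau>)) * ?y (T + \<tau>) * exp (- \<nu> * t)"
      by (intro mult_right_mono) auto
    moreover have "exp (\<nu> * t) * ?y t * exp (- \<nu> * t) = ?y t" by (simp add: exp_minus)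
    ultimately show ?thesis by (simp only:)
  qed
  have "filterlim (\<lambda>t. - \<nu> * t) at_bot at_top"
    by (rule filterlim_tendsto_neg_mult_at_bot[OF tendsto_const _ filterlim_ident]) (use nu in simp)
  then have "((\<lambda>t. exp (\<nu> * (T + \<tau>)) * ?y (T + \<tau>) * exp (- \<nu> * t)) \<longlongrightarrow> 0) at_top"
    by (intro tendsto_mult_right_zero filterlim_compose[OF exp_at_bot])
  then have "(?y \<longlongrightarrow> 0) at_top"
  proof (rule tendsto_sandwich[of "\<lambda>_. 0", rotated 3])
    show "\<forall>\<^sub>F t in at_top. 0 \<le> ?y t"
      using eventually_ge_at_top[of T] by eventually_elim (use above in force)
    show "\<forall>\<^sub>F t in at_top. ?y t \<le> exp (\<nu> * (T + \<tau>)) * ?y (T + \<tau>) * exp (- \<nu> * t)"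
      using eventually_ge_at_top[of "T + \<tau>"] by eventually_elim (rule decay)
  qed simp
  then show "(profile \<longlongrightarrow> ln p) at_top" by (simp add: LIM_zero_iff)
qed

end

section \<open>The wave equation and the bound \<open>\<zeta>\<close>\<close>

text \<open>Each average contributes a first-order equation; eliminating \<open>forcing\<close>
  between the two gives the second-order profile equation with coefficient
  \<open>1 / c\<^sup>2\<close>.\<close>

lemma (in wave_params) nicholson_solution_profile:
  assumes c: "c > 0" and nz: "\<nu> * z = c\<^sup>2" "z - \<nu> = c\<^sup>2"
  shows "nicholson_solution \<tau> p (\<lambda>t x. profile ((x + c * t) / c))"
proof -
  let ?s = "\<lambda>t x. (x + c * t) / c"
  define \<phi>1 where "\<phi>1 s = \<nu> * (forcing s - profile s)" for s
  define \<phi>2 where "\<phi>2 s = \<nu> * (z * (forcing s - delayed profile s) - \<phi>1 s)" for s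
  have d1: "(profile has_real_derivative \<phi>1 s) (at s)" for s
    unfolding \<phi>1_def by (rule profile_deriv)
  have d2: "(\<phi>1 has_real_derivative \<phi>2 s) (at s)" for s
    unfolding \<phi>2_def \<phi>1_def[abs_def]
    by (rule derivative_eq_intros forcing_deriv profile_deriv refl | simp)+
  have st: "((\<lambda>t. ?s t x) has_real_derivative 1) (at t)" for t x
    using c by (auto intro!: derivative_eq_intros)
  have sx: "((\<lambda>x. ?s t x) has_real_derivative 1 / c) (at x)" for t x
    using c by (auto intro!: derivative_eq_intros)
  have \<nu>: "\<nu> / c * \<nu> / c = 1 - \<nu>"
    using nz c by (simp add: field_simps power2_eq_square)
  have ode: "\<phi>1 s = \<phi>2 s / c\<^sup>2 - profile s + delayed profile s" for s
  proof -
    have "\<phi>2 s = c\<^sup>2 * (forcing s - delayed profile s) - \<nu> * \<nu> * (forcing s - profile s)"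
      unfolding \<phi>2_def \<phi>1_def nz(1)[symmetric] by (simp add: algebra_simps)
    then have "\<phi>2 s / c\<^sup>2 = forcing s - delayed profile s - \<nu> / c * \<nu> / c * (forcing s - profile s)"
      using c by (simp add: diff_divide_distrib power2_eq_square)
    then show ?thesis unfolding \<nu> by (simp add: \<phi>1_def algebra_simps)
  qed
  have cF: "continuous_on A (delayed profile)" for A
    using delayed_profile_bcontfun continuous_on_subset by (auto simp: bcontfun_def)
  have c1: "continuous_on UNIV \<phi>1"
    unfolding \<phi>1_def[abs_def] by (intro continuous_intros forcing_cont profile_cont)
  have c2: "continuous_on UNIV \<phi>2"
    unfolding \<phi>2_def[abs_def] by (intro continuous_intros forcing_cont cF c1)
  have cs: "continuous_on UNIV (\<lambda>(t, x). g (?s t x))" if "continuous_on UNIV g" for g :: "real \<Rightarrow> real"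
    unfolding case_prod_unfold using c
    by (intro continuous_on_compose2[OF that] continuous_intros) auto
  show ?thesis
    unfolding nicholson_solution_def
  proof (intro exI conjI allI)
    show "continuous_on UNIV (\<lambda>(t, x). \<phi>1 (?s t x))" by (rule cs[OF c1])
    show "continuous_on UNIV (\<lambda>(t, x). \<phi>1 (?s t x) / c)"
      using c by (intro cs[of "\<lambda>s. \<phi>1 s / c"] continuous_intros c1) auto
    show "continuous_on UNIV (\<lambda>(t, x). \<phi>2 (?s t x) / c\<^sup>2)"
      using c by (intro cs[of "\<lambda>s. \<phi>2 s / c\<^sup>2"] continuous_intros c2) auto
    fix t x
    show "((\<lambda>t. profile (?s t x)) has_real_derivative \<phi>1 (?s t x)) (at t)"
      using DERIV_chain'[OF st d1] by simp
    show "((\<lambda>x. profile (?s t x)) has_real_derivative \<phi>1 (?s t x) / c) (at x)"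
      using DERIV_chain'[OF sx d1] by simp
    show "((\<lambda>x. \<phi>1 (?s t x) / c) has_real_derivative \<phi>2 (?s t x) / c\<^sup>2) (at x)"
      using DERIV_cdivide[OF DERIV_chain'[OF sx d2], of t c x] by (simp add: power2_eq_square)
    have "?s (t - \<tau>) x = ?s t x - \<tau>" using c by (simp add: field_simps)
    then show "\<phi>1 (?s t x) = \<phi>2 (?s t x) / c\<^sup>2 - profile (?s t x)
        + p * profile (?s (t - \<tau>) x) * exp (- profile (?s (t - \<tau>) x))"
      using ode[of "?s t x"] by (simp only: delayed_def nich_def)
  qed
qed

section \<open>The integral form of \<zeta> and the limit of infinite speed\<close>

lemma mu_root:
  assumes "\<tau> > 0" "p > 1"
  shows "mu_root \<tau> p > 0" "char_fun \<tau> p (mu_root \<tau> p) = 0"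
  using theI'[OF char_fun_ex1_pos_root[OF assms]] by (auto simp: mu_root_def)

lemma char_fun_strict_mono:
  assumes "\<tau> > 0" "p > 1" "a < b"
  shows "char_fun \<tau> p a < char_fun \<tau> p b"
proof -
  have "p * exp (- b * \<tau>) \<le> p * exp (- a * \<tau>)" using assms by (intro mult_left_mono) auto
  then show ?thesis using assms(3) unfolding char_fun_def by linarith
qed

text \<open>The substitution t = exp (\<mu> * (s - \<tau>)) turns \<open>t powr (1 / \<mu>)\<close>
  into \<open>exp (s - \<tau>)\<close> and {0..\<tau>} into the range between the two Gamma
  arguments. So \<zeta> is variation of constants with \<nu> = 1 over one delay interval.\<close>

lemma zeta_val_eq:
  fixes \<tau> p
  defines "\<mu> \<equiv> mu_root \<tau> p" and "q \<equiv> q2 \<tau> p"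
  assumes tau: "\<tau> > 0" and p: "p > 1"
  shows "zeta_val \<tau> p = exp (- \<tau>) * (1 + q + integral {0..\<tau>} (\<lambda>s. exp s *
    (p * (exp (\<mu> * (s - \<tau>)) + q * exp (2 * \<mu> * (s - \<tau>))) * exp (- exp (\<mu> * (s - \<tau>))))))"
proof -
  have mu: "\<mu> > 0" unfolding \<mu>_def by (rule mu_root[OF tau p])
  define m where "m = inverse \<mu>"
  define a where "a = exp (- \<mu> * \<tau>)"
  have m: "m > 0" "m * \<mu> = 1" using mu by (simp_all add: m_def)
  have a: "0 < a" "a \<le> 1" using mu tau by (simp_all add: a_def)
  define g where "g s = exp (\<mu> * (s - \<tau>))" for s
  define h where "h t = t powr m * exp (- t) + q * (t powr (m + 1) * exp (- t))" for t :: real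
  have cont: "continuous_on A (\<lambda>t. t powr r * exp (- t))" if "r > 0" "A \<subseteq> {0..}" for A :: "real set" and r
    using that by (intro continuous_intros continuous_on_powr') auto
  have diff: "lower_Gamma 1 (r + 1) - lower_Gamma a (r + 1) = integral {a..1} (\<lambda>t. t powr r * exp (- t))"
    if "r > 0" for r
    using Henstock_Kurzweil_Integration.integral_combine[where a = 0 and c = a and b = 1 and f = "\<lambda>t. t powr r * exp (- t)"] a that
      integrable_continuous_interval[OF cont[of r "{0..1}"]]
    by (simp add: lower_Gamma_def)
  have int: "(\<lambda>t. t powr r * exp (- t)) integrable_on {a..1}" if "r > 0" for r
    using a that by (intro integrable_continuous_interval cont) auto
  have "integral {a..1} h = integral {a..1} (\<lambda>t. t powr m * exp (- t))
      + q * integral {a..1} (\<lambda>t. t powr (m + 1) * exp (- t))"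
    unfolding h_def using m by (subst integral_add) (auto intro!: int integrable_on_mult_right)
  also have "\<dots> = lower_Gamma 1 (m + 1) - lower_Gamma a (m + 1)
      + q * (lower_Gamma 1 (m + 2) - lower_Gamma a (m + 2))"
    using diff[of m] diff[of "m + 1"] m by (simp add: add.assoc)
  finally have h_eq: "integral {a..1} h = lower_Gamma 1 (m + 1) - lower_Gamma a (m + 1)
      + q * (lower_Gamma 1 (m + 2) - lower_Gamma a (m + 2))" .
  have \<zeta>: "zeta_val \<tau> p = (1 + q) * exp (- \<tau>) + p * m * integral {a..1} h"
    unfolding h_eq by (simp add: zeta_val_def Let_def m_def a_def \<mu>_def q_def algebra_simps)
  have "((\<lambda>s. (\<mu> * g s) *\<^sub>R h (g s)) has_integral integral {g 0..g \<tau>} h) {0..\<tau>}"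
  proof (rule has_integral_substitution)
    show "g 0 \<le> g \<tau>" "g ` {0..\<tau>} \<subseteq> {a..1}"
      using mu tau by (auto simp: g_def a_def mult_nonneg_nonpos right_diff_distrib)
    show "continuous_on {a..1} h"
      unfolding h_def using m a by (intro continuous_intros cont) auto
    show "(g has_real_derivative \<mu> * g s) (at s within {0..\<tau>})" for s
      unfolding g_def[abs_def] by (auto intro!: derivative_eq_intros)
  qed (use tau in simp)
  then have "integral {a..1} h = integral {0..\<tau>} (\<lambda>s. \<mu> * g s * h (g s))"
    by (simp add: integral_unique g_def a_def)
  then have "p * m * integral {a..1} h = integral {0..\<tau>} (\<lambda>s. p * m * (\<mu> * g s * h (g s)))"
    by simp
  also have "\<dots> = integral {0..\<tau>} (\<lambda>s. exp (- \<tau>) * (exp s *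
    (p * (exp (\<mu> * (s - \<tau>)) + q * exp (2 * \<mu> * (s - \<tau>))) * exp (- exp (\<mu> * (s - \<tau>))))))"
  proof (rule integral_cong)
    fix s
    have e: "g s powr m = exp (- \<tau>) * exp s"
    proof -
      have "m * (\<mu> * (s - \<tau>)) = s - \<tau>" using m by (simp add: mult.assoc[symmetric])
      moreover have "g s powr m = exp (m * (\<mu> * (s - \<tau>)))" by (simp add: g_def powr_def)
      ultimately show ?thesis by (simp flip: exp_add)
    qed
    have "g s powr (m + 1) = g s powr m * g s"
      by (simp add: powr_add g_def)
    then have "h (g s) = exp (- \<tau>) * exp s * (1 + q * g s) * exp (- g s)"
      by (simp add: h_def e algebra_simps)
    then have "p * m * (\<mu> * g s * h (g s))
      = (m * \<mu>) * (exp (- \<tau>) * (exp s * (p * (g s + q * (g s * g s)) * exp (- g s))))"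
      by (simp add: algebra_simps)
    also have "g s * g s = exp (2 * \<mu> * (s - \<tau>))" by (simp add: g_def flip: exp_add)
    finally show "p * m * (\<mu> * g s * h (g s)) = exp (- \<tau>) * (exp s *
      (p * (exp (\<mu> * (s - \<tau>)) + q * exp (2 * \<mu> * (s - \<tau>))) * exp (- exp (\<mu> * (s - \<tau>)))))"
      by (simp only: m mult_1 g_def)
  qed
  also note integral_mult_right
  finally show ?thesis unfolding \<zeta> by (simp only: distrib_left mult.commute[of "1 + q"])
qed

text \<open>The strict inequality leaves the margin that absorbs the error terms at finite speed: the definition of
  \<open>\<zeta>\<close> estimates the damping \<open>exp (- \<phi>)\<close> by \<open>exp (- exp (\<mu> * t))\<close>, whereas \<open>x * exp (- x)\<close> is monotone on
  \<open>{0..1}\<close>, so that the subsolution may be inserted in both places.\<close>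

lemma zeta_val_less_tau_bound:
  assumes tau: "\<tau> > 0" and p: "p > 1"
  shows "zeta_val \<tau> p < tau_bound \<tau> p 1 (mu_root \<tau> p) (q2 \<tau> p)"
proof -
  define \<mu> where "\<mu> = mu_root \<tau> p"
  define q where "q = q2 \<tau> p"
  have mu: "\<mu> > 0" unfolding \<mu>_def by (rule mu_root[OF tau p])
  have "char_fun \<tau> p (2 * \<mu>) > 0"
    using char_fun_strict_mono[OF tau p, of \<mu> "2 * \<mu>"] mu mu_root(2)[OF tau p] by (simp add: \<mu>_def)
  then have q: "q < 0" using p by (simp add: q_def q2_def \<mu>_def divide_neg_pos)
  let ?g = "\<lambda>s. exp (\<mu> * (s - \<tau>))"
  let ?l = "\<lambda>s. ?g s + q * exp (2 * \<mu> * (s - \<tau>))"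
  let ?A = "\<lambda>s. exp s * (p * ?l s * exp (- ?g s))"
  let ?B = "\<lambda>s. exp s * nich p (max 0 (?l s))"
  have l_less: "?l s < ?g s" for s using q by (simp add: mult_neg_pos)
  have AB: "?A s \<le> ?B s" "?l s \<noteq> 0 \<Longrightarrow> ?A s < ?B s" for s
  proof -
    consider "?l s < 0" | "?l s = 0" | "?l s > 0" by linarith
    then have "?A s < ?B s \<or> ?l s = 0 \<and> ?A s = ?B s"
    proof cases
      case 1
      then have "p * ?l s * exp (- ?g s) < 0" using p by (intro mult_neg_pos mult_pos_neg) auto
      moreover have "max 0 (?l s) = 0" using 1 by simp
      ultimately show ?thesis by (simp add: nich_def mult_pos_neg)
    next
      case 2
      then show ?thesis by (simp add: nich_def)
    next
      case 3
      then have "p * ?l s * exp (- ?g s) < p * ?l s * exp (- ?l s)"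
        using p l_less[of s] by (intro mult_strict_left_mono) auto
      moreover have "max 0 (?l s) = ?l s" using 3 by simp
      ultimately show ?thesis by (simp add: nich_def)
    qed
    then show "?A s \<le> ?B s" "?l s \<noteq> 0 \<Longrightarrow> ?A s < ?B s" by auto
  qed
  have cA: "continuous_on {0..\<tau>} ?A" and cB: "continuous_on {0..\<tau>} ?B"
    by (intro continuous_intros)+
  have le: "integral {0..\<tau>} ?A \<le> integral {0..\<tau>} ?B"
    by (intro integral_le integrable_continuous_interval cA cB AB(1))
  \<comment> \<open>Equal integrals of ordered continuous functions would make them equal pointwise,
    hence the subsolution zero on the whole interval; but
    \<open>1 + q * exp (\<mu> * (s - \<tau>))\<close> differs at the two endpoints.\<close>
  have "integral {0..\<tau>} ?A \<noteq> integral {0..\<tau>} ?B"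
  proof
    assume "integral {0..\<tau>} ?A = integral {0..\<tau>} ?B"
    then have "integral {0..\<tau>} (\<lambda>s. ?B s - ?A s) = 0"
      by (subst integral_diff) (auto intro: integrable_continuous_interval cA cB)
    moreover have "0 \<le> ?B s - ?A s" for s using AB(1)[of s] by (simp only: diff_ge_0_iff_ge)
    ultimately have "\<forall>s\<in>{0..\<tau>}. ?B s - ?A s = 0"
      using integral_eq_0_iff[OF continuous_on_diff[OF cB cA] tau] by (simp only: simp_thms)
    then have l0: "?l s = 0" if "s \<in> {0..\<tau>}" for s using AB(2)[of s] that by fastforce
    have "1 + q * ?g s = 0" if "s \<in> {0..\<tau>}" for s
    proof -
      have "?l s = ?g s * (1 + q * ?g s)" by (simp add: algebra_simps flip: exp_add)
      then show ?thesis using l0[OF that] by simp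
    qed
    from this[of 0] this[of \<tau>] have "1 + q * ?g 0 = 1 + q * ?g \<tau>" using tau by simp
    then show False using q mu tau unfolding add_left_cancel mult_cancel_left exp_inj_iff by simp
  qed
  with le have "integral {0..\<tau>} ?A < integral {0..\<tau>} ?B" by simp
  then show ?thesis
    unfolding zeta_val_eq[OF tau p] tau_bound_def \<mu>_def[symmetric] q_def[symmetric]
    by simp
qed

lemma continuous_tau_bound:
  "continuous_on UNIV (\<lambda>(\<nu>, \<mu>, q). tau_bound \<tau> p \<nu> \<mu> q)"
proof -
  have "continuous_on UNIV (\<lambda>x :: real \<times> real \<times> real. integral (cbox 0 \<tau>) (\<lambda>s. fst x * exp (fst x * s) *
    nich p (max 0 (exp (fst (snd x) * (s - \<tau>)) + snd (snd x) * exp (2 * fst (snd x) * (s - \<tau>))))))"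
    by (rule integral_continuous_on_param) (unfold case_prod_unfold, intro continuous_intros)
  then show ?thesis
    unfolding tau_bound_def case_prod_unfold by (intro continuous_intros) simp
qed

section \<open>Wavefronts of large speed\<close>

lemma dist_Pair_le: "dist (a, b) (c, d) \<le> dist a c + dist b d"
  using sqrt_sum_squares_le_sum_abs[of "dist a c" "dist b d"] by (simp add: dist_Pair_Pair)

text \<open>\<open>z\<close> and \<open>- \<nu>\<close> are the roots of x^2 / c^2 - x - 1. Written
  without subtraction, \<nu> is visibly at most 1 and tends to 1 as c grows.\<close>

lemma speed_roots:
  fixes c :: real
  defines "r \<equiv> sqrt (1 + 4 / c\<^sup>2)"
  defines "\<nu> \<equiv> 2 / (1 + r)" and "z \<equiv> c\<^sup>2 * (1 + r) / 2"
  assumes c: "c > 0"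
  shows "0 < \<nu>" "\<nu> \<le> 1" "\<nu> * z = c\<^sup>2" "z - \<nu> = c\<^sup>2"
proof -
  have r: "r \<ge> 1" by (simp add: r_def)
  have "r\<^sup>2 = 1 + 4 / c\<^sup>2" by (simp add: r_def)
  then have r2: "c\<^sup>2 * r\<^sup>2 = c\<^sup>2 + 4" using c by (simp add: field_simps)
  show "0 < \<nu>" "\<nu> \<le> 1" "\<nu> * z = c\<^sup>2" using r c by (auto simp: \<nu>_def z_def field_simps)
  have "\<nu> = c\<^sup>2 * (r - 1) / 2"
    using r r2 by (simp add: \<nu>_def field_simps power2_eq_square)
  then show "z - \<nu> = c\<^sup>2" by (simp add: z_def algebra_simps)
qed

text \<open>Thus \<open>char\<close> is the characteristic equation at 0 for speed c, a perturbation
  of \<open>char_fun\<close> by the square of the rate over \<open>c\<^sup>2\<close>.\<close>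

lemma gain_speed:
  assumes "c > 0" "\<nu> * z = c\<^sup>2" "z - \<nu> = c\<^sup>2"
  shows "gain \<nu> z l = 1 / (1 + l - l\<^sup>2 / c\<^sup>2)"
proof -
  have "(\<nu> + l) * (z - l) = \<nu> * z + l * (z - \<nu>) - l\<^sup>2"
    by (simp add: algebra_simps power2_eq_square)
  also have "\<dots> = c\<^sup>2 * (1 + l - l\<^sup>2 / c\<^sup>2)"
    using assms by (simp add: algebra_simps)
  finally show ?thesis using assms by (simp add: gain_def)
qed

text \<open>The coefficient \<open>q\<close> at speed c, with e for \<open>1 / c\<^sup>2\<close> and
  m for the leading rate. It also makes sense at e = 0, where m = \<open>mu_root \<tau> p\<close>
  gives \<open>q2\<close>, so infinite speed becomes an ordinary point of continuity.\<close>

definition q_speed :: "real \<Rightarrow> real \<Rightarrow> real \<Rightarrow> real \<Rightarrow> real" where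
  "q_speed \<tau> p e m = - (p * exp (- 2 * m * \<tau>)) / (1 + 2 * m - e * (2 * m)\<^sup>2 - p * exp (- 2 * m * \<tau>))"

lemma wave_params_speed:
  assumes "\<tau> > 0" "p > 1" "c > 0" "0 < \<nu>" "\<nu> \<le> 1" and nz: "\<nu> * z = c\<^sup>2" "z - \<nu> = c\<^sup>2"
    and m: "0 < m" "2 * m < z" "1 + m - m\<^sup>2 / c\<^sup>2 = p * exp (- m * \<tau>)"
    and pos: "1 + 2 * m - 1 / c\<^sup>2 * (2 * m)\<^sup>2 - p * exp (- 2 * m * \<tau>) > 0"
  shows "wave_params \<tau> p \<nu> z m" "wave_params.q \<tau> p \<nu> z m = q_speed \<tau> p (1 / c\<^sup>2) m"
proof -
  let ?k = "p * exp (- 2 * m * \<tau>)"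
  let ?D = "1 + 2 * m - 1 / c\<^sup>2 * (2 * m)\<^sup>2"
  have D: "gain \<nu> z (2 * m) = 1 / ?D"
    using gain_speed[OF assms(3) nz, of "2 * m"] by simp
  have k0: "?k > 0" using assms(2) by simp
  then have D0: "?D > 0" using pos by linarith
  show wp: "wave_params \<tau> p \<nu> z m"
  proof
    show "p * exp (- m * \<tau>) * gain \<nu> z m = 1"
      unfolding gain_speed[OF assms(3) nz] m(3) using assms(2) by simp
    show "p * exp (- 2 * m * \<tau>) * gain \<nu> z (2 * m) < 1"
      unfolding D using D0 pos by (simp only: mult_1_right times_divide_eq_right divide_less_eq_1_pos)
  qed (use assms in auto)
  have rate: "wave_params.rate \<tau> p \<nu> z m = ?k / ?D"
    unfolding wave_params.rate_def[OF wp] D by simp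
  have "- (?k / ?D) / (1 - ?k / ?D) = - ?k / (?D - ?k)"
  proof -
    have "- (k / D) / (1 - k / D) = - k / (D - k)" if "D > 0" "D - k > 0" for k D :: real
      using that by (simp add: field_simps)
    from this[OF D0 pos] show ?thesis .
  qed
  then show "wave_params.q \<tau> p \<nu> z m = q_speed \<tau> p (1 / c\<^sup>2) m"
    unfolding wave_params.q_def[OF wp] rate q_speed_def .
qed

lemma (in wave_params) profile_speed_wavefront:
  assumes c: "c > 0" and nz: "\<nu> * z = c\<^sup>2" "z - \<nu> = c\<^sup>2"
    and lnp: "ln p \<ge> 1" and above: "\<And>t. \<tau> \<le> t \<Longrightarrow> profile t > ln p"
    and \<zeta>: "profile \<tau> \<ge> \<zeta>" "\<zeta> > ln p"
  defines "\<phi> \<equiv> \<lambda>x. profile (x / c)"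
  shows "positive_wavefront \<tau> p c \<phi> \<and> ev_monotone_at_bot \<phi> \<and> ev_monotone_at_top \<phi> \<and>
    \<not> monotone_real_on UNIV \<phi> \<and> sup_norm \<phi> \<ge> \<zeta>"
proof (intro conjI)
  note top = profile_decreasing_to_equilibrium[OF lnp above]
  have lim_bot: "(\<phi> \<longlongrightarrow> 0) at_bot"
    unfolding \<phi>_def
    using filterlim_compose[OF profile_tendsto_0
        filterlim_tendsto_pos_mult_at_bot[OF tendsto_const _ filterlim_ident, of "1 / c"]] c by simp
  have lim_top: "(\<phi> \<longlongrightarrow> ln p) at_top"
    unfolding \<phi>_def
    using filterlim_compose[OF top(2)
        filterlim_tendsto_pos_mult_at_top[OF tendsto_const _ filterlim_ident, of "1 / c"]] c by simp
  show "positive_wavefront \<tau> p c \<phi>"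
    using nicholson_solution_profile[OF c nz] lim_bot lim_top profile_pos
    unfolding positive_wavefront_def wavefront_def by (simp add: \<phi>_def)
  obtain T where T: "mono_on {..T} profile" using profile_eventually_increasing by blast
  have "mono_on {..c * T} \<phi>"
  proof (rule mono_onI)
    fix r s assume "r \<in> {..c * T}" "s \<in> {..c * T}" "r \<le> s"
    then show "\<phi> r \<le> \<phi> s"
      unfolding \<phi>_def using c by (intro mono_onD[OF T]) (auto simp: field_simps)
  qed
  then show "ev_monotone_at_bot \<phi>"
    unfolding ev_monotone_at_bot_def monotone_real_on_def by blast
  have "antimono_on {c * (\<tau> + \<tau>)..} \<phi>"
  proof (rule monotone_onI)
    fix r s assume "r \<in> {c * (\<tau> + \<tau>)..}" "s \<in> {c * (\<tau> + \<tau>)..}" "r \<le> s"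
    then show "\<phi> s \<le> \<phi> r"
      unfolding \<phi>_def using c by (intro monotone_onD[OF top(1)]) (auto simp: field_simps)
  qed
  then show "ev_monotone_at_top \<phi>"
    unfolding ev_monotone_at_top_def monotone_real_on_def by blast
  have \<phi>\<tau>: "\<phi> (c * \<tau>) \<ge> \<zeta>" using c \<zeta> by (simp add: \<phi>_def)
  show "\<not> monotone_real_on UNIV \<phi>"
  proof
    assume "monotone_real_on UNIV \<phi>"
    then consider "mono_on UNIV \<phi>" | "antimono_on UNIV \<phi>" by (auto simp: monotone_real_on_def)
    then show False
    proof cases
      case 1
      have "\<forall>\<^sub>F x in at_top. \<zeta> \<le> \<phi> x"
        using eventually_ge_at_top[of "c * \<tau>"]
        by eventually_elim (use \<phi>\<tau> mono_onD[OF 1] in force)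
      then have "\<zeta> \<le> ln p" by (rule tendsto_lowerbound[OF lim_top]) simp
      then show False using \<zeta> by simp
    next
      case 2
      have "\<forall>\<^sub>F x in at_bot. \<phi> 0 \<le> \<phi> x"
        using eventually_le_at_bot[of 0] by eventually_elim (use monotone_onD[OF 2] in force)
      then have "\<phi> 0 \<le> 0" by (rule tendsto_lowerbound[OF lim_bot]) simp
      then show False using profile_pos[of 0] by (simp add: \<phi>_def)
    qed
  qed
  have "bdd_above (range (\<lambda>x. \<bar>\<phi> x\<bar>))"
    by (rule bdd_aboveI2[of _ _ p]) (simp add: \<phi>_def abs_le_iff profile_le_p profile_nonneg
        order_trans[OF _ profile_nonneg] p0 less_imp_le add_increasing)
  then have "\<bar>\<phi> (c * \<tau>)\<bar> \<le> sup_norm \<phi>"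
    unfolding sup_norm_def by (rule cSUP_upper[rotated]) simp
  then show "\<zeta> \<le> sup_norm \<phi>" using \<phi>\<tau> by linarith
qed

theorem theorem1:
  fixes \<tau> p :: real
  assumes "\<tau> > 0"
    and "p \<in> {exp 2 <..< exp (1 + exp (- 1 - \<tau>) / \<tau>)}"
    and "zeta_val \<tau> p > ln p"
  shows "\<exists>c_hat > 0. \<forall>c \<ge> c_hat. \<exists>\<phi>.
    positive_wavefront \<tau> p c \<phi> \<and>
    ev_monotone_at_bot \<phi> \<and> ev_monotone_at_top \<phi> \<and>
    \<not> monotone_real_on UNIV \<phi> \<and>
    sup_norm \<phi> \<ge> zeta_val \<tau> p \<and> zeta_val \<tau> p > ln p"
proof -
  note tau = assms(1)
  have p1: "p > 1" using assms(2) one_less_exp_iff[of "2::real"] by (simp del: one_less_exp_iff)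
  have lnp2: "ln p > 2"
    using ln_less_cancel_iff[of "exp 2" p] assms(2) p1 by simp
  have "ln p < 1 + exp (- 1 - \<tau>) / \<tau>"
    using ln_less_cancel_iff[of p "exp (1 + exp (- 1 - \<tau>) / \<tau>)"] assms(2) p1 by simp
  then have "(ln p - 1) * exp (\<tau> + 1) < exp (- 1 - \<tau>) / \<tau> * exp (\<tau> + 1)"
    by (intro mult_strict_right_mono) auto
  also have "\<dots> = 1 / \<tau>" by (simp flip: exp_add)
  finally have slope: "(ln p - 1) * exp (\<tau> + 1) < 1 / \<tau>" .

  define \<mu> where "\<mu> = mu_root \<tau> p"
  have mu: "\<mu> > 0" "char_fun \<tau> p \<mu> = 0" unfolding \<mu>_def by (rule mu_root[OF tau p1])+
  have q0: "q_speed \<tau> p 0 \<mu> = q2 \<tau> p"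
    by (simp add: q_speed_def q2_def char_fun_def \<mu>_def algebra_simps)
  \<comment> \<open>A third of the margin: one part is lost by passing to finite speed, one by the
    error \<open>2 * p\<^sup>2 / l\<close>, and one remains as the overshoot required by
    \<open>profile_overshoots\<close>.\<close>
  define \<delta> where "\<delta> = (tau_bound \<tau> p 1 \<mu> (q2 \<tau> p) - zeta_val \<tau> p) / 3"
  have d: "\<delta> > 0" using zeta_val_less_tau_bound[OF tau p1] by (simp add: \<delta>_def \<mu>_def)

  define \<Delta> where "\<Delta> = (\<lambda>x :: real \<times> real \<times> real. 1 + 2 * snd (snd x) - fst (snd x) * (2 * snd (snd x))\<^sup>2
    - p * exp (- 2 * snd (snd x) * \<tau>))"
  define J where "J = (\<lambda>x. tau_bound \<tau> p (fst x) (snd (snd x)) (q_speed \<tau> p (fst (snd x)) (snd (snd x))))"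
  \<comment> \<open>The triple of \<nu>, \<open>1 / c\<^sup>2\<close> and leading rate at infinite
    speed; \<open>\<Delta>\<close> is the denominator of \<open>q_speed\<close> in these
    coordinates.\<close>
  let ?x0 = "(1 :: real, 0 :: real, \<mu>)"
  have "char_fun \<tau> p (2 * \<mu>) > 0"
    using char_fun_strict_mono[OF tau p1, of \<mu> "2 * \<mu>"] mu by simp
  then have \<Delta>0: "\<Delta> ?x0 > 0" by (simp add: \<Delta>_def char_fun_def)
  have \<Delta>_lim: "(\<Delta> \<longlongrightarrow> \<Delta> ?x0) (nhds ?x0)"
    unfolding \<Delta>_def by (intro tendsto_intros filterlim_ident)
  have args_lim: "((\<lambda>x. (fst x, snd (snd x), - (p * exp (- 2 * snd (snd x) * \<tau>)) / \<Delta> x))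
    \<longlongrightarrow> (fst ?x0, snd (snd ?x0), - (p * exp (- 2 * snd (snd ?x0) * \<tau>)) / \<Delta> ?x0)) (nhds ?x0)"
    using \<Delta>0 by (intro tendsto_intros \<Delta>_lim filterlim_ident) auto
  have "isCont (\<lambda>(\<nu>, \<mu>, q). tau_bound \<tau> p \<nu> \<mu> q) y" for y
    using continuous_tau_bound[of \<tau> p] continuous_on_eq_continuous_at[OF open_UNIV] by blast
  from isCont_tendsto_compose[OF this args_lim]
  have J_lim: "(J \<longlongrightarrow> J ?x0) (nhds ?x0)"
    by (simp add: J_def q_speed_def \<Delta>_def)
  have "J ?x0 = zeta_val \<tau> p + 3 * \<delta>" by (simp add: J_def q0 \<delta>_def field_simps)
  then have "\<forall>\<^sub>F x in nhds ?x0. zeta_val \<tau> p + 2 * \<delta> < J x"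
    using d by (intro order_tendstoD(1)[OF J_lim]) simp
  moreover have "\<forall>\<^sub>F x in nhds ?x0. 0 < \<Delta> x" by (rule order_tendstoD(1)[OF \<Delta>_lim \<Delta>0])
  ultimately have "\<forall>\<^sub>F x in nhds ?x0. zeta_val \<tau> p + 2 * \<delta> < J x \<and> 0 < \<Delta> x"
    by (rule eventually_conj)
  then obtain \<rho> where \<rho>: "\<rho> > 0"
    and near: "\<And>x. dist x ?x0 < \<rho> \<Longrightarrow> zeta_val \<tau> p + 2 * \<delta> < J x \<and> 0 < \<Delta> x"
    unfolding eventually_nhds_metric by blast

  \<comment> \<open>In the limit of large \<open>l\<close> the cone hypothesis reduces to
    \<open>slope\<close>, which is strict. So \<open>l\<close> can be fixed here, independently of
    c.\<close>
  have cone_lim: "((\<lambda>l. 1 + (ln p - 1) * (1 + 4 * p / l / \<delta>) * exp (\<tau> + 1)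
      + 6 * p * (exp (\<tau> + 1) * (1 + p / \<delta>)) * exp (- l * \<tau>))
    \<longlongrightarrow> 1 + (ln p - 1) * (1 + 0 / \<delta>) * exp (\<tau> + 1) + 6 * p * (exp (\<tau> + 1) * (1 + p / \<delta>)) * 0) at_top"
  proof -
    have "filterlim (\<lambda>l. - \<tau> * l) at_bot at_top"
      by (rule filterlim_tendsto_neg_mult_at_bot[OF tendsto_const _ filterlim_ident]) (use tau in simp)
    then have "((\<lambda>l. exp (- l * \<tau>)) \<longlongrightarrow> 0) at_top"
      by (intro filterlim_compose[OF exp_at_bot]) (simp add: mult.commute)
    moreover have "((\<lambda>l. 4 * p / l) \<longlongrightarrow> 0) at_top"
      by (intro tendsto_divide_0[OF tendsto_const] filterlim_at_top_imp_at_infinity filterlim_ident)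
    ultimately show ?thesis using d by (intro tendsto_intros) auto
  qed
  have "\<forall>\<^sub>F l in at_top. 1 + (ln p - 1) * (1 + 4 * p / l / \<delta>) * exp (\<tau> + 1)
      + 6 * p * (exp (\<tau> + 1) * (1 + p / \<delta>)) * exp (- l * \<tau>) < 1 + 1 / \<tau>"
    using slope by (intro order_tendstoD(2)[OF cone_lim]) simp
  moreover have "\<forall>\<^sub>F l in at_top. 10 * p\<^sup>2 / l < \<delta>"
    by (intro order_tendstoD(2)[OF tendsto_divide_0[OF tendsto_const]] filterlim_at_top_imp_at_infinity
        filterlim_ident d)
  moreover have "\<forall>\<^sub>F l in at_top. 4 * p + 4 \<le> l" by (rule eventually_ge_at_top)
  ultimately have "\<forall>\<^sub>F l in at_top. 1 + (ln p - 1) * (1 + 4 * p / l / \<delta>) * exp (\<tau> + 1)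
      + 6 * p * (exp (\<tau> + 1) * (1 + p / \<delta>)) * exp (- l * \<tau>) < 1 + 1 / \<tau>
      \<and> 10 * p\<^sup>2 / l < \<delta> \<and> 4 * p + 4 \<le> l"
    by eventually_elim blast
  from eventually_happens'[OF trivial_limit_at_top_linorder this] obtain l where l: "1 + (ln p - 1) * (1 + 4 * p / l / \<delta>) * exp (\<tau> + 1)
      + 6 * p * (exp (\<tau> + 1) * (1 + p / \<delta>)) * exp (- l * \<tau>) < 1 + 1 / \<tau>"
    "10 * p\<^sup>2 / l < \<delta>" "4 * p + 4 \<le> l" by blast
  have l0: "l > 0" using l(3) p1 by linarith

  \<comment> \<open>The leading rate is confined to an interval of length \<open>\<rho> / 4\<close>;
    with two further errors below \<open>\<rho> / 3\<close> the total distance to \<open>?x0\<close>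
    stays below \<rho>.\<close>
  define m1 where "m1 = \<mu> + \<rho> / 4"
  have m1: "\<mu> < m1" using \<rho> by (simp add: m1_def)
  have \<chi>1: "char_fun \<tau> p m1 > 0"
    using char_fun_strict_mono[OF tau p1 m1] mu by simp
  define \<nu> where "\<nu> c = 2 / (1 + sqrt (1 + 4 / c\<^sup>2))" for c :: real
  define z where "z c = c\<^sup>2 * (1 + sqrt (1 + 4 / c\<^sup>2)) / 2" for c :: real
  have sq_top: "filterlim (\<lambda>c :: real. c\<^sup>2) at_top at_top"
    by (intro filterlim_pow_at_top filterlim_ident) simp
  have inv_lim: "((\<lambda>c :: real. b / c\<^sup>2) \<longlongrightarrow> 0) at_top" for b
    by (intro tendsto_divide_0[OF tendsto_const] filterlim_at_top_imp_at_infinity sq_top)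
  have "(\<nu> \<longlongrightarrow> 2 / (1 + sqrt (1 + 0))) at_top"
    unfolding \<nu>_def by (intro tendsto_intros inv_lim) simp
  then have "\<forall>\<^sub>F c in at_top. dist (\<nu> c) 1 < \<rho> / 3" using \<rho> by (intro tendstoD) auto
  moreover have "\<forall>\<^sub>F c :: real in at_top. 1 / c\<^sup>2 < \<rho> / 3"
    using \<rho> by (intro order_tendstoD(2)[OF inv_lim]) simp
  moreover have "\<forall>\<^sub>F c :: real in at_top. m1\<^sup>2 / c\<^sup>2 < char_fun \<tau> p m1"
    by (rule order_tendstoD(2)[OF inv_lim \<chi>1])
  moreover have "\<forall>\<^sub>F c :: real in at_top. 2 * m1 + 2 * l + (8 * p + 8) \<le> c\<^sup>2"
    using sq_top by (simp add: filterlim_at_top)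
  ultimately have "\<forall>\<^sub>F c in at_top. dist (\<nu> c) 1 < \<rho> / 3 \<and> 1 / c\<^sup>2 < \<rho> / 3 \<and>
      m1\<^sup>2 / c\<^sup>2 < char_fun \<tau> p m1 \<and> 2 * m1 + 2 * l + (8 * p + 8) \<le> c\<^sup>2"
    by eventually_elim blast
  then obtain c0 where c0: "\<And>c. c0 \<le> c \<Longrightarrow> dist (\<nu> c) 1 < \<rho> / 3 \<and> 1 / c\<^sup>2 < \<rho> / 3 \<and>
      m1\<^sup>2 / c\<^sup>2 < char_fun \<tau> p m1 \<and> 2 * m1 + 2 * l + (8 * p + 8) \<le> c\<^sup>2"
    unfolding eventually_at_top_linorder by blast

  have "\<exists>\<phi>. positive_wavefront \<tau> p c \<phi> \<and> ev_monotone_at_bot \<phi> \<and> ev_monotone_at_top \<phi> \<and>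
    \<not> monotone_real_on UNIV \<phi> \<and> sup_norm \<phi> \<ge> zeta_val \<tau> p"
    if c: "max c0 1 \<le> c" for c
  proof -
    have cpos: "c > 0" using c by simp
    have big: "dist (\<nu> c) 1 < \<rho> / 3" "1 / c\<^sup>2 < \<rho> / 3" "m1\<^sup>2 / c\<^sup>2 < char_fun \<tau> p m1"
      "2 * m1 + 2 * l + (8 * p + 8) \<le> c\<^sup>2"
      using c0[of c] c by auto
    note roots = speed_roots[OF cpos, folded \<nu>_def z_def]
    have z: "c\<^sup>2 \<le> z c" using roots(1,4) by linarith
    let ?\<chi> = "\<lambda>m. char_fun \<tau> p m - m\<^sup>2 / c\<^sup>2"
    \<comment> \<open>The leading rate at speed c: \<open>?\<chi>\<close> equals - \<mu>^2 / c^2 at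
      \<mu>, and is positive at \<open>m1\<close> for c large.\<close>
    have "\<exists>m\<ge>\<mu>. m \<le> m1 \<and> ?\<chi> m = 0"
    proof (rule IVT')
      show "continuous_on {\<mu>..m1} ?\<chi>"
        unfolding char_fun_def using cpos by (intro continuous_intros) auto
    qed (use mu m1 big(3) in auto)
    then obtain m where m: "\<mu> \<le> m" "m \<le> m1" "?\<chi> m = 0" by blast
    have "dist (\<nu> c, 1 / c\<^sup>2, m) ?x0 \<le> dist (\<nu> c) 1 + dist (1 / c\<^sup>2, m) (0, \<mu>)"
      by (rule dist_Pair_le)
    also have "dist (1 / c\<^sup>2, m) (0, \<mu>) \<le> dist (1 / c\<^sup>2) 0 + dist m \<mu>"
      by (rule dist_Pair_le)
    also have "dist (1 / c\<^sup>2) 0 < \<rho> / 3" using big(2) by simp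
    also have "dist m \<mu> \<le> \<rho> / 4" using m by (simp add: dist_real_def m1_def)
    finally have "dist (\<nu> c, 1 / c\<^sup>2, m) ?x0 < \<rho>" using big(1) \<rho> by linarith
    note nearby = near[OF this]
    have mpos: "m > 0" using m mu by simp
    have "2 * m < z c" using m big(4) z l0 p1 by linarith
    moreover have "1 + m - m\<^sup>2 / c\<^sup>2 = p * exp (- m * \<tau>)"
      using m(3) by (simp add: char_fun_def)
    moreover have "1 + 2 * m - 1 / c\<^sup>2 * (2 * m)\<^sup>2 - p * exp (- 2 * m * \<tau>) > 0"
      using nearby by (simp add: \<Delta>_def)
    ultimately have params: "wave_params \<tau> p (\<nu> c) (z c) m"
      and q: "wave_params.q \<tau> p (\<nu> c) (z c) m = q_speed \<tau> p (1 / c\<^sup>2) m"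
      using wave_params_speed[OF tau p1 cpos roots mpos] by blast+
    interpret wave_params \<tau> p "\<nu> c" "z c" m by (rule params)
    have lz: "2 * l \<le> z c" "8 * p + 8 \<le> z c" using big(4) z l0 p1 m mpos by linarith+
    have "2 * p\<^sup>2 / l \<le> 10 * p\<^sup>2 / l" using l0 by (intro divide_right_mono) auto
    then have over: "profile \<tau> \<ge> zeta_val \<tau> p + \<delta>"
      using profile_tau_ge[OF l0 lz(1)] nearby l(2) by (simp add: J_def q)
    have "profile t > ln p" if "\<tau> \<le> t" for t
      by (rule profile_overshoots[OF _ d l(3) lz(2,1) _ _ l(1) that]) (use over assms(3) lnp2 l(2) in auto)
    from profile_speed_wavefront[OF cpos roots(3,4) _ this _ assms(3)]
    show ?thesis using over d lnp2 by (intro exI) auto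
  qed
  then show ?thesis
    using assms(3) by (intro exI[of _ "max c0 1"]) auto
qed

end
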